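(* Let $s\ge 0$ and $0\le t\le 62$ be integers and let $n=63s+t$ with $n\ge 51$. Then the following hold. (a) If $t\notin\{21,22,25,26,33,34,37,38,45,46\}$, then $d_l(n,6)=32s+\delta(t)$, where $\delta(t)$ is given by: $\delta(t)=-2$ for $t\in\{0,1\}$; $\delta(t)=-1$ for $t=2$; $\delta(t)=0$ for $t\in\{3,4,5\}$; $\delta(t)=1$ for $t=6$; $\delta(t)=2$ for $t\in\{7,8,9\}$; $\delta(t)=3$ for $t=10$; $\delta(t)=4$ for $t\in\{11,12,13\}$; $\delta(t)=5$ for $t=14$; $\delta(t)=6$ for $t\in\{15,16,17\}$; $\delta(t)=7$ for $t=18$; $\delta(t)=8$ for $t\in\{19,20\}$; $\delta(t)=10$ for $t\in\{23,24\}$; $\delta(t)=12$ for $t\in\{27,28,29\}$; $\delta(t)=13$ for $t=30$; $\delta(t)=14$ for $t\in\{31,32\}$; $\delta(t)=16$ for $t\in\{35,36\}$; $\delta(t)=18$ for $t\in\{39,40\}$; $\delta(t)=19$ for $t=41$; $\delta(t)=20$ for $t\in\{42,43,44\}$; $\delta(t)=22$ for $t\in\{47,48\}$; $\delta(t)=23$ for $t=49$; $\delta(t)=24$ for $t\in\{50,51,52\}$; $\delta(t)=25$ for $t=53$; $\delta(t)=26$ for $t\in\{54,55,56\}$; $\delta(t)=27$ for $t=57$; $\delta(t)=28$ for $t\in\{58,59,60\}$; $\delta(t)=29$ for $t=61$; $\delta(t)=30$ for $t=62$. (b) If $t\in\{21,22,26,34,37,38,46\}$, then $d_l(n,6)\in\{d_a(n,6)-1,\,d_a(n,6)\}$,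 where $d_a(n,6)=32s+9,\ 32s+10,\ 32s+12,\ 32s+16,\ 32s+17,\ 32s+18,\ 32s+22$ for $t=21,22,26,34,37,38,46$ respectively. (c) If $t\in\{25,33,45\}$, then $d_l(n,6)\in\{d_a(n,6)-2,\,d_a(n,6)-1\}$, where $d_a(n,6)=32s+12,\ 32s+16,\ 32s+22$ for $t=25,33,45$ respectively.
   Context: All codes are binary: a linear $[n,k]$ code is a $k$-dimensional subspace $\mathcal C$ of $\mathbb F_2^n$, and an $[n,k,d]$ code is an $[n,k]$ code whose minimum weight of nonzero codewords is exactly $d$. Only codes without zero coordinates are considered (no coordinate position is identically $0$ on $\mathcal C$). The dual $\mathcal C^{\perp}$ is taken with respect to the standard inner product $x\cdot y=xy^T$. The code $\mathcal C$ is linear complementary dual (LCD) if $\mathcal C\cap\mathcal C^{\perp}=\{0\}$. $d_a(n,k)$ denotes the largest minimum distance among all binary linear $[n,k]$ codes, and $d_l(n,k)$ denotes the largest minimum distance among all binary LCD $[n,k]$ codes. *)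

theory Defs
  imports "HOL-Library.Z2" "Jordan_Normal_Form.VS_Connect"
begin

text \<open>
  Binary codes of length n are sets of vectors over \<^typ>\<open>bit\<close>, the field with two elements,
  whose entries are indexed by {0..<n}. As in the source, codes with an identically zero
  coordinate are excluded throughout, so this requirement is part of the notion of a code.
\<close>

definition no_zero_coordinate :: "nat \<Rightarrow> bit vec set \<Rightarrow> bool" where
  "no_zero_coordinate n C \<longleftrightarrow> (\<forall>i<n. \<exists>c\<in>C. c $ i \<noteq> 0)"

definition linear_code :: "nat \<Rightarrow> nat \<Rightarrow> bit vec set \<Rightarrow> bool" where
  "linear_code n k C \<longleftrightarrow>
     VectorSpace.subspace class_ring C (module_vec TYPE(bit) n) \<and>
     vectorspace.dim class_ring ((module_vec TYPE(bit) n)\<lparr>carrier := C\<rparr>) = k \<and>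
     no_zero_coordinate n C"

definition hamming_weight :: "bit vec \<Rightarrow> nat" where
  "hamming_weight v = card {i. i < dim_vec v \<and> v $ i \<noteq> 0}"

text \<open>Only meaningful for codes containing a nonzero word, i.e. of dimension at least 1.\<close>

definition minimum_distance :: "nat \<Rightarrow> bit vec set \<Rightarrow> nat" where
  "minimum_distance n C = Min (hamming_weight ` (C - {0\<^sub>v n}))"

definition dual_code :: "nat \<Rightarrow> bit vec set \<Rightarrow> bit vec set" where
  "dual_code n C = {x \<in> carrier_vec n. \<forall>y\<in>C. x \<bullet> y = 0}"

definition LCD :: "nat \<Rightarrow> bit vec set \<Rightarrow> bool" where
  "LCD n C \<longleftrightarrow> C \<inter> dual_code n C = {0\<^sub>v n}"

text \<open>
  The maxima below are over finite sets, all minimum distances being at most n when k > 0;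
  they are only meaningful when an (LCD) [n,k] code with k > 0 exists.
\<close>

definition d_a :: "nat \<Rightarrow> nat \<Rightarrow> nat" where
  "d_a n k = Max {minimum_distance n C | C. linear_code n k C}"

definition d_l :: "nat \<Rightarrow> nat \<Rightarrow> nat" where
  "d_l n k = Max {minimum_distance n C | C. linear_code n k C \<and> LCD n C}"

definition delta :: "nat \<Rightarrow> int" where
  "delta t =
    (if t \<in> {0, 1} then -2
     else if t = 2 then -1
     else if t \<in> {3, 4, 5} then 0
     else if t = 6 then 1
     else if t \<in> {7, 8, 9} then 2
     else if t = 10 then 3
     else if t \<in> {11, 12, 13} then 4
     else if t = 14 then 5
     else if t \<in> {15, 16, 17} then 6
     else if t = 18 then 7
     else if t \<in> {19, 20} then 8
     else if t \<in> {23, 24} then 10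
     else if t \<in> {27, 28, 29} then 12
     else if t = 30 then 13
     else if t \<in> {31, 32} then 14
     else if t \<in> {35, 36} then 16
     else if t \<in> {39, 40} then 18
     else if t = 41 then 19
     else if t \<in> {42, 43, 44} then 20
     else if t \<in> {47, 48} then 22
     else if t = 49 then 23
     else if t \<in> {50, 51, 52} then 24
     else if t = 53 then 25
     else if t \<in> {54, 55, 56} then 26
     else if t = 57 then 27
     else if t \<in> {58, 59, 60} then 28
     else if t = 61 then 29
     else if t = 62 then 30
     else undefined)"

end

(* For a binary code C with all inner products given by b, the Gauss sum S, the sum of i^w(c) over C,
   satisfies |S|^2 = |C| times the sum of i^w(z) over the hull.  Hence C of dimension 6 is LCD if and
   only if |S|^2 = 64, which determines the numbers of words of weight 0, 1, 2, 3 modulo 4 up to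
   finitely many cases: S is one of 8, -8, 8i, -8i.

   Upper bounds.  Let C be LCD with all nonzero weights at least d, where d is even.  Rounding d up to
   the residue modulo 4 of each weight gives a lower bound for the total weight 32n.  If C has a word of
   odd weight, this already yields 32n >= 63d + 86.  Otherwise 32n < 63d + 82 would leave only a
   multiset g of at most six words of excess; the congruences modulo 16 for the weight sums over
   complements of hyperplanes show that the number of elements of g not orthogonal to z is congruent to
   w(z) modulo 4, so g would carry a nondegenerate even form of rank six, which needs seven elements.
   The parity extension of an LCD [n,6] code is again LCD: otherwise the even subcode would be
   nondegenerate of dimension 5, and 32 is not a square.  This reduces odd d to even d.

   Adding a copy of the simplex code changes n by 63 and all weights by 32, so 32n - 63d is invariant
   and the lower bounds reduce to one code for each of the lengths 51, ..., 113. *)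

theory Submission
  imports Defs
begin

section \<open>Binary codes as finite sets\<close>

(* Otherwise the simplifier turns sums and products of bits into xor and and. *)
declare add_bit_eq_xor [simp del] mult_bit_eq_and [simp del]

text \<open>The code \<open>C\<close> stays one fixed set of words of known cardinality, while the
  family of linear forms that counts as its coordinates varies: all coordinates, these together with
  a parity check, or those vanishing at a word. So parity extensions and residual codes need no new
  vector spaces; words that become zero in a residual code are collected in a set of exceptions. The
  constant 82 is 54 + 4 * 7. In the even case the Gauss sum is 8 or -8, so both even residue classes
  modulo 4 have at least 28 words, and rounding costs at least 2 * 28, of which the zero word bears
  at most 2. Seven units of 4 are one more than \<open>g\<close> could have. Six are impossible
  because the sets of words of \<open>g\<close> not orthogonal to a given word would run through all
  subsets of its support, and a singleton would come from a word of odd weight. The values of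
  \<open>d_a\<close> need bounds for arbitrary codes. Averaging, after parity extension for odd
  distances, suffices except at t = 21 and t = 37, where it still allows 32 * s + 10 and 32 * s +
  18; two residual steps exclude these.\<close>

lemma (in vectorspace) card_carrier_eq_power_dim:
  assumes fin: "finite (carrier V)"
  shows "card (carrier V) = card (carrier K) ^ dim"
proof -
  have "gen_set (carrier V)"
    using in_own_span[of "carrier V"] span_is_subset2[of "carrier V"] by auto
  then have "fin_dim"
    unfolding fin_dim_def using fin by blast
  then obtain B where B: "finite B" "basis B"
    using finite_basis_exists by blast
  have sub: "B \<subseteq> carrier V"
    using B(2) by (simp add: basis_def)
  have uniq: "\<exists>!a. a \<in> B \<rightarrow>\<^sub>E carrier K \<and> lincomb a B = v" if "v \<in> carrier V" for v
    using basis_criterion[OF B(1) sub] B(2) that by blast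
  have closed: "lincomb a B \<in> carrier V" if "a \<in> B \<rightarrow>\<^sub>E carrier K" for a
    using that sub by (intro lincomb_closed) (auto simp: PiE_def)
  have "bij_betw (\<lambda>a. lincomb a B) (B \<rightarrow>\<^sub>E carrier K) (carrier V)"
    unfolding bij_betw_def
  proof
    show "inj_on (\<lambda>a. lincomb a B) (B \<rightarrow>\<^sub>E carrier K)"
      using uniq closed by (intro inj_onI) metis
    show "(\<lambda>a. lincomb a B) ` (B \<rightarrow>\<^sub>E carrier K) = carrier V"
      using uniq closed by (auto simp: image_iff) metis
  qed
  then have "card (carrier V) = card (B \<rightarrow>\<^sub>E carrier K)"
    by (simp add: bij_betw_same_card)
  then show ?thesis
    using B dim_basis by (simp add: card_PiE)
qed

lemma UNIV_bit: "(UNIV :: bit set) = {0, 1}"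
  using bit.exhaust by auto

lemma bit_add_self [simp]: "a + a = (0 :: bit)"
  by (cases a) simp_all

lemma finite_carrier_vec_bit: "finite (carrier_vec n :: bit vec set)"
proof -
  have "carrier_vec n \<subseteq> vec_of_list ` {xs :: bit list. set xs \<subseteq> {0, 1} \<and> length xs = n}"
  proof
    fix v :: "bit vec" assume "v \<in> carrier_vec n"
    then have "v = vec_of_list (list_of_vec v)" "length (list_of_vec v) = n"
      by (auto simp: vec_list)
    then show "v \<in> vec_of_list ` {xs :: bit list. set xs \<subseteq> {0, 1} \<and> length xs = n}"
      using UNIV_bit by blast
  qed
  then show ?thesis
    by (rule finite_subset) (intro finite_imageI finite_lists_length_eq, simp)
qed

locale binary_code =
  fixes n :: nat and C :: "bit vec set"
  assumes carrier: "C \<subseteq> carrier_vec n"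
    and zero_mem: "0\<^sub>v n \<in> C"
    and add_mem: "x \<in> C \<Longrightarrow> y \<in> C \<Longrightarrow> x + y \<in> C"

lemma subspace_iff_binary_code:
  "VectorSpace.subspace class_ring C (module_vec TYPE(bit) n) \<longleftrightarrow> binary_code n C"
proof
  assume "VectorSpace.subspace class_ring C (module_vec TYPE(bit) n)"
  then have "submodule class_ring C (module_vec TYPE(bit) n)"
    by (simp add: VectorSpace.subspace_def)
  then show "binary_code n C"
    by (auto simp: submodule_def binary_code_def module_vec_simps)
next
  assume C: "binary_code n C"
  interpret vec_space "TYPE(bit)" n .
  have "a \<cdot>\<^sub>v v \<in> C" if "v \<in> C" for a v
  proof -
    have "v \<in> carrier_vec n"
      using that C by (auto simp: binary_code_def)
    then have "0 \<cdot>\<^sub>v v = 0\<^sub>v n" "1 \<cdot>\<^sub>v v = v" by auto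
    then show ?thesis
      using that C by (cases a) (auto simp: binary_code_def)
  qed
  then show "VectorSpace.subspace class_ring C (module_vec TYPE(bit) n)"
    using C vec_vs[where 'a = bit, of n] vec_module[where 'a = bit, of n]
    by (simp add: VectorSpace.subspace_def submodule_def binary_code_def module_vec_simps)
qed

context binary_code
begin

lemma finite_code: "finite C"
  using finite_subset[OF carrier finite_carrier_vec_bit] .

lemma dim_iff_card:
  "vectorspace.dim class_ring ((module_vec TYPE(bit) n)\<lparr>carrier := C\<rparr>) = k \<longleftrightarrow> card C = 2 ^ k"
proof -
  interpret V: vec_space "TYPE(bit)" n .
  interpret W: vectorspace class_ring "(module_vec TYPE(bit) n)\<lparr>carrier := C\<rparr>"
    by (rule V.subspace_is_vs) (use binary_code_axioms subspace_iff_binary_code in blast)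
  have "card C = 2 ^ W.dim"
    using W.card_carrier_eq_power_dim finite_code by (simp add: UNIV_bit numeral_2_eq_2)
  then show ?thesis
    by simp
qed

lemma add_cancel:
  assumes "x \<in> C" "y \<in> C"
  shows "(x + y) + y = x"
proof -
  have "x \<in> carrier_vec n" "y \<in> carrier_vec n"
    using assms carrier by blast+
  then show ?thesis
    by (intro eq_vecI) (auto simp: add.assoc)
qed

end

lemma linear_code_iff:
  "linear_code n k C \<longleftrightarrow> binary_code n C \<and> card C = 2 ^ k \<and> no_zero_coordinate n C"
  using binary_code.dim_iff_card[of n C k]
  unfolding linear_code_def subspace_iff_binary_code by blast

section \<open>Gauss sums of coordinatized codes\<close>

definition sign :: "bit \<Rightarrow> int" where
  "sign a = (if a = 0 then 1 else -1)"

lemma sign_simps [simp]: "sign 0 = 1" "sign 1 = -1"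
  by (simp_all add: sign_def)

lemma sign_add: "sign (a + b) = sign a * sign b"
  by (cases a; cases b) simp_all

lemma sign_eq_power: "sign (of_nat m) = (-1) ^ m"
  by (induction m) (simp_all add: sign_add)

lemma of_nat_bit_eq_0_iff: "(of_nat m :: bit) = 0 \<longleftrightarrow> even m"
  using even_of_nat[where 'a = bit, of m] by (cases "of_nat m :: bit") simp_all

context binary_code
begin

definition linear_form :: "(bit vec \<Rightarrow> bit) \<Rightarrow> bool" where
  "linear_form \<phi> \<longleftrightarrow> (\<forall>x\<in>C. \<forall>y\<in>C. \<phi> (x + y) = \<phi> x + \<phi> y)"

lemma linear_form_add: "linear_form \<phi> \<Longrightarrow> x \<in> C \<Longrightarrow> y \<in> C \<Longrightarrow> \<phi> (x + y) = \<phi> x + \<phi> y"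
  by (simp add: linear_form_def)

lemma linear_form_plus:
  assumes "linear_form \<phi>" "linear_form \<psi>"
  shows "linear_form (\<lambda>c. \<phi> c + \<psi> c)"
  using assms by (auto simp: linear_form_def algebra_simps)

lemma linear_form_zero:
  assumes "linear_form \<phi>" shows "\<phi> (0\<^sub>v n) = 0"
proof -
  have "\<phi> (0\<^sub>v n + 0\<^sub>v n) = \<phi> (0\<^sub>v n) + \<phi> (0\<^sub>v n)"
    using linear_form_add[OF assms] zero_mem by blast
  then show ?thesis by simp
qed

lemma bij_betw_translation:
  assumes "z \<in> C" shows "bij_betw (\<lambda>c. c + z) C C"
  by (rule bij_betwI[where g = "\<lambda>c. c + z"]) (use assms add_mem add_cancel in auto)

lemma sum_translation:
  assumes "z \<in> C" shows "(\<Sum>c\<in>C. f (c + z)) = (\<Sum>c\<in>C. f c)"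
  using sum.reindex_bij_betw[OF bij_betw_translation[OF assms]] .

lemma sum_sign_linear_form:
  assumes \<phi>: "linear_form \<phi>"
  shows "(\<Sum>c\<in>C. sign (\<phi> c)) = (if \<forall>c\<in>C. \<phi> c = 0 then int (card C) else 0)"
proof (cases "\<forall>c\<in>C. \<phi> c = 0")
  case False
  then obtain z where z: "z \<in> C" "\<phi> z = 1" by auto
  have "(\<Sum>c\<in>C. sign (\<phi> c)) = (\<Sum>c\<in>C. sign (\<phi> (c + z)))"
    using sum_translation[OF z(1), of "\<lambda>c. sign (\<phi> c)"] by simp
  also have "\<dots> = (\<Sum>c\<in>C. - sign (\<phi> c))"
    by (intro sum.cong) (auto simp: linear_form_add[OF \<phi>] z sign_add)
  finally have "(\<Sum>c\<in>C. sign (\<phi> c)) = 0"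
    by (simp add: sum_negf)
  then show ?thesis
    using False by auto
qed simp

lemma of_bool_eq_sign: "2 * of_bool (a = 1) = 1 - sign a"
  by (cases a) simp_all

text \<open>Four times the product of the two indicators is 1 - sign a - sign b + sign (a + b), and
  each of these characters sums to 0 or \<open>card C\<close>. The unspecified factor
  \<open>k\<close> covers equal, vanishing and independent forms alike; with 64 words the count is a
  multiple of 16.\<close>

lemma card_one_one:
  assumes \<phi>: "linear_form \<phi>" and \<psi>: "linear_form \<psi>"
  shows "\<exists>k. 4 * card {c\<in>C. \<phi> c = 1 \<and> \<psi> c = 1} = k * card C"
proof -
  let ?\<sigma> = "\<lambda>\<phi>. \<Sum>c\<in>C. sign (\<phi> c)"
  have mult: "\<exists>k. ?\<sigma> \<phi> = k * int (card C)" if "linear_form \<phi>" for \<phi>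
    using sum_sign_linear_form[OF that] by (auto intro: exI[of _ 0] exI[of _ 1])
  have "int (4 * card {c\<in>C. \<phi> c = 1 \<and> \<psi> c = 1})
      = (\<Sum>c\<in>C. (2 * of_bool (\<phi> c = 1)) * (2 * of_bool (\<psi> c = 1)))"
  proof -
    have "int (card {c\<in>C. \<phi> c = 1 \<and> \<psi> c = 1}) = (\<Sum>c\<in>C. of_bool (\<phi> c = 1 \<and> \<psi> c = 1))"
      using finite_code by (simp add: Int_def)
    also have "4 * \<dots> = (\<Sum>c\<in>C. (2 * of_bool (\<phi> c = 1)) * (2 * of_bool (\<psi> c = 1)))"
      unfolding sum_distrib_left by (intro sum.cong) auto
    finally show ?thesis
      by simp
  qed
  also have "\<dots> = (\<Sum>c\<in>C. 1 - sign (\<phi> c) - sign (\<psi> c) + sign (\<phi> c + \<psi> c))"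
    unfolding of_bool_eq_sign sign_add by (simp add: algebra_simps)
  also have "\<dots> = int (card C) - ?\<sigma> \<phi> - ?\<sigma> \<psi> + ?\<sigma> (\<lambda>c. \<phi> c + \<psi> c)"
    by (simp add: sum.distrib sum_subtractf)
  also obtain a b d where "\<dots> = int (card C) - a * int (card C) - b * int (card C) + d * int (card C)"
    using mult[OF \<phi>] mult[OF \<psi>] mult[OF linear_form_plus[OF \<phi> \<psi>]] by metis
  also have "\<dots> = (1 - a - b + d) * int (card C)"
    by (simp add: algebra_simps)
  finally have *: "int (4 * card {c\<in>C. \<phi> c = 1 \<and> \<psi> c = 1}) = (1 - a - b + d) * int (card C)" .
  have "card C > 0"
    using zero_mem finite_code card_gt_0_iff by blast
  with * have "0 \<le> 1 - a - b + d"
    by (smt (verit) of_nat_0_le_iff of_nat_0_less_iff mult_neg_pos)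
  then have "int (4 * card {c\<in>C. \<phi> c = 1 \<and> \<psi> c = 1}) = int (nat (1 - a - b + d) * card C)"
    using * by simp
  then show ?thesis
    using of_nat_eq_iff by blast
qed

lemma card_one:
  assumes \<phi>: "linear_form \<phi>"
  shows "2 * card {c\<in>C. \<phi> c = 1} = (if \<forall>c\<in>C. \<phi> c = 0 then 0 else card C)"
proof -
  have "int (2 * card {c\<in>C. \<phi> c = 1}) = (\<Sum>c\<in>C. 2 * of_bool (\<phi> c = 1))"
    using finite_code by (simp add: Int_def flip: sum_distrib_left)
  also have "\<dots> = int (card C) - (\<Sum>c\<in>C. sign (\<phi> c))"
    unfolding of_bool_eq_sign by (simp add: sum_subtractf)
  finally show ?thesis
    unfolding sum_sign_linear_form[OF \<phi>] by (auto split: if_splits)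
qed

end

locale coordinatized_code = binary_code +
  fixes I :: "'i set" and \<phi> :: "'i \<Rightarrow> bit vec \<Rightarrow> bit"
  assumes finite_index: "finite I"
    and linear: "i \<in> I \<Longrightarrow> linear_form (\<phi> i)"
begin

definition weight :: "bit vec \<Rightarrow> nat" where
  "weight c = card {i\<in>I. \<phi> i c = 1}"

definition form :: "bit vec \<Rightarrow> bit vec \<Rightarrow> bit" where
  "form x y = (\<Sum>i\<in>I. \<phi> i x * \<phi> i y)"

lemma form_eq_card: "form x y = of_nat (card {i\<in>I. \<phi> i x = 1 \<and> \<phi> i y = 1})"
proof -
  have "form x y = (\<Sum>i\<in>I. if \<phi> i x = 1 \<and> \<phi> i y = 1 then 1 else 0)"
    unfolding form_def
  proof (rule sum.cong)
    fix i show "\<phi> i x * \<phi> i y = (if \<phi> i x = 1 \<and> \<phi> i y = 1 then 1 else 0)"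
      by (cases "\<phi> i x"; cases "\<phi> i y") simp_all
  qed simp
  then show ?thesis
    by (simp add: finite_index sum.If_cases Int_def)
qed

lemma form_sym: "form x y = form y x"
  by (simp add: form_def mult.commute)

lemma form_linear:
  assumes "x \<in> C" shows "linear_form (form x)"
proof -
  have "form x (y + z) = form x y + form x z" if "y \<in> C" "z \<in> C" for y z
    unfolding form_def sum.distrib[symmetric]
    by (intro sum.cong) (auto simp: linear_form_add[OF linear] that distrib_left)
  then show ?thesis by (simp add: linear_form_def)
qed

lemma form_linear':
  assumes "x \<in> C" shows "linear_form (\<lambda>y. form y x)"
  using form_linear[OF assms] by (subst form_sym)

lemma weight_zero [simp]: "weight (0\<^sub>v n) = 0"
  by (auto simp: weight_def finite_index linear_form_zero[OF linear])

lemma weight_add: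
  assumes "x \<in> C" "y \<in> C"
  shows "weight (x + y) + 2 * card {i\<in>I. \<phi> i x = 1 \<and> \<phi> i y = 1} = weight x + weight y"
proof -
  let ?X = "{i\<in>I. \<phi> i x = 1}" and ?Y = "{i\<in>I. \<phi> i y = 1}"
  have fin: "finite ?X" "finite ?Y"
    using finite_index by auto
  have "\<phi> i (x + y) = 1 \<longleftrightarrow> (\<phi> i x = 1) \<noteq> (\<phi> i y = 1)" if "i \<in> I" for i
    by (cases "\<phi> i x"; cases "\<phi> i y") (auto simp: linear_form_add[OF linear[OF that]] assms)
  then have eq: "{i\<in>I. \<phi> i (x + y) = 1} = (?X - ?Y) \<union> (?Y - ?X)"
    by auto
  have int: "{i\<in>I. \<phi> i x = 1 \<and> \<phi> i y = 1} = ?X \<inter> ?Y"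
    by auto
  have "card ((?X - ?Y) \<union> (?Y - ?X)) = card (?X - ?Y) + card (?Y - ?X)"
    using fin by (intro card_Un_disjoint) auto
  moreover have "card (?X - ?Y) + card (?X \<inter> ?Y) = card ?X" "card (?Y - ?X) + card (?X \<inter> ?Y) = card ?Y"
    using fin card_Diff_subset_Int[of ?X ?Y] card_Diff_subset_Int[of ?Y ?X]
      card_mono[of ?X "?X \<inter> ?Y"] card_mono[of ?Y "?X \<inter> ?Y"]
    by (auto simp: Int_commute)
  ultimately show ?thesis
    unfolding weight_def eq int by linarith
qed

lemma parity_linear: "linear_form (\<lambda>c. of_nat (weight c))"
proof -
  have "(of_nat (weight (x + y)) :: bit) = of_nat (weight x) + of_nat (weight y)"
    if "x \<in> C" "y \<in> C" for x y
    unfolding of_nat_add[symmetric] weight_add[OF that, symmetric] by simp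
  then show ?thesis
    by (simp add: linear_form_def)
qed

text \<open>Addition loses the overlap of the supports twice, and as the square of i is -1 this
  becomes the sign of the inner product: the weight modulo 4 is a quadratic refinement of
  \<open>form\<close>.\<close>

lemma i_power_weight_add:
  assumes "x \<in> C" "y \<in> C"
  shows "\<i> ^ weight (x + y) = \<i> ^ weight x * \<i> ^ weight y * of_int (sign (form x y))"
proof -
  let ?m = "card {i\<in>I. \<phi> i x = 1 \<and> \<phi> i y = 1}"
  have "\<i> ^ weight x * \<i> ^ weight y = \<i> ^ weight (x + y) * (\<i> ^ 2) ^ ?m"
    unfolding power_mult[symmetric] power_add[symmetric] weight_add[OF assms] ..
  then have "\<i> ^ weight x * \<i> ^ weight y * (-1) ^ ?m = \<i> ^ weight (x + y) * ((-1) ^ ?m * (-1) ^ ?m)"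
    by simp
  also have "(-1) ^ ?m * (-1) ^ ?m = (1 :: complex)"
    by (simp flip: power_mult_distrib)
  finally show ?thesis
    by (simp add: form_eq_card sign_eq_power)
qed

definition gauss_sum :: complex where
  "gauss_sum = (\<Sum>c\<in>C. \<i> ^ weight c)"

definition radical :: "bit vec set" where
  "radical = {z\<in>C. \<forall>c\<in>C. form c z = 0}"

text \<open>Writing the first variable of the double sum as \<open>z + c\<close> leaves, for each
  \<open>z\<close>, the sum over \<open>c\<close> of the character \<open>sign (form c z)\<close>,
  which vanishes unless \<open>z\<close> is orthogonal to all of \<open>C\<close>.\<close>

lemma gauss_sum_norm:
  "gauss_sum * cnj gauss_sum = of_nat (card C) * (\<Sum>z\<in>radical. \<i> ^ weight z)"
proof -
  have unit: "\<i> ^ m * cnj (\<i> ^ m) = 1" for m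
    by (simp flip: power_mult_distrib)
  have "gauss_sum * cnj gauss_sum = (\<Sum>c\<in>C. gauss_sum * cnj (\<i> ^ weight c))"
    by (subst (2) gauss_sum_def) (simp add: sum_distrib_left)
  also have "\<dots> = (\<Sum>c\<in>C. \<Sum>z\<in>C. \<i> ^ weight z * of_int (sign (form c z)))"
  proof (rule sum.cong)
    fix c assume c: "c \<in> C"
    have "gauss_sum * cnj (\<i> ^ weight c) = (\<Sum>z\<in>C. \<i> ^ weight (z + c) * cnj (\<i> ^ weight c))"
      unfolding gauss_sum_def
      by (subst sum_translation[OF c, symmetric]) (simp only: sum_distrib_right)
    also have "\<dots> = (\<Sum>z\<in>C. \<i> ^ weight z * of_int (sign (form z c)) * (\<i> ^ weight c * cnj (\<i> ^ weight c)))"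
      by (intro sum.cong refl) (simp add: i_power_weight_add c mult_ac)
    also have "\<dots> = (\<Sum>z\<in>C. \<i> ^ weight z * of_int (sign (form c z)))"
      by (simp only: unit form_sym[of _ c] mult_1_right)
    finally show "gauss_sum * cnj (\<i> ^ weight c) = (\<Sum>z\<in>C. \<i> ^ weight z * of_int (sign (form c z)))" .
  qed simp
  also have "\<dots> = (\<Sum>z\<in>C. \<i> ^ weight z * of_int (\<Sum>c\<in>C. sign (form c z)))"
    by (subst sum.swap) (simp add: sum_distrib_left)
  also have "\<dots> = (\<Sum>z\<in>C. if \<forall>c\<in>C. form c z = 0 then \<i> ^ weight z * of_nat (card C) else 0)"
    by (intro sum.cong refl) (simp add: sum_sign_linear_form[OF form_linear'])
  also have "\<dots> = (\<Sum>z\<in>radical. \<i> ^ weight z * of_nat (card C))"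
    by (simp add: radical_def sum.If_cases finite_code Int_def)
  finally show ?thesis
    by (simp add: sum_distrib_left mult.commute)
qed

lemma zero_mem_radical: "0\<^sub>v n \<in> radical"
  by (simp add: radical_def zero_mem linear_form_zero[OF form_linear])

lemma radical_closed: "x \<in> radical \<Longrightarrow> y \<in> radical \<Longrightarrow> x + y \<in> radical"
  by (simp add: radical_def add_mem linear_form_add[OF form_linear])

end

lemma Re_Im_i_power:
  "Re (\<i> ^ m) = of_bool (m mod 4 = 0) - of_bool (m mod 4 = 2)"
  "Im (\<i> ^ m) = of_bool (m mod 4 = 1) - of_bool (m mod 4 = 3)"
proof -
  have "\<i> ^ m = \<i> ^ (4 * (m div 4) + m mod 4)"
    by simp
  also have "\<dots> = \<i> ^ (m mod 4)"
    unfolding power_add power_mult by simp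
  finally have *: "\<i> ^ m = \<i> ^ (m mod 4)" .
  have "m mod 4 \<in> {0, 1, 2, 3}"
    by auto
  then show "Re (\<i> ^ m) = of_bool (m mod 4 = 0) - of_bool (m mod 4 = 2)"
    "Im (\<i> ^ m) = of_bool (m mod 4 = 1) - of_bool (m mod 4 = 3)"
    unfolding * by (auto simp: power3_eq_cube)
qed

lemma sum_two_squares_eq_64:
  fixes a b :: int
  assumes "a\<^sup>2 + b\<^sup>2 = 64"
  shows "a \<in> {-8, 8} \<and> b = 0 \<or> a = 0 \<and> b \<in> {-8, 8}"
proof -
  have range: "\<bar>x\<bar> \<in> {0, 1, 2, 3, 4, 5, 6, 7, 8}" if "x\<^sup>2 \<le> 64" for x :: int
  proof -
    have "x\<^sup>2 \<le> 8\<^sup>2"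
      using that by simp
    then have "\<bar>x\<bar> \<le> 8"
      unfolding abs_le_square_iff[symmetric] by simp
    then show ?thesis
      by simp arith
  qed
  have "a\<^sup>2 \<le> 64" "b\<^sup>2 \<le> 64"
    using assms zero_le_power2[of a] zero_le_power2[of b] by linarith+
  then have "\<bar>a\<bar> \<in> {0, 1, 2, 3, 4, 5, 6, 7, 8}" "\<bar>b\<bar> \<in> {0, 1, 2, 3, 4, 5, 6, 7, 8}"
    using range by blast+
  moreover have "x = 8 \<and> y = 0 \<or> x = 0 \<and> y = 8"
    if "x\<^sup>2 + y\<^sup>2 = 64" "x \<in> {0, 1, 2, 3, 4, 5, 6, 7, 8}" "y \<in> {0, 1, 2, 3, 4, 5, 6, 7, 8}" for x y :: int
    using that by auto
  moreover have "\<bar>a\<bar>\<^sup>2 + \<bar>b\<bar>\<^sup>2 = 64"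
    using assms by simp
  ultimately have "\<bar>a\<bar> = 8 \<and> \<bar>b\<bar> = 0 \<or> \<bar>a\<bar> = 0 \<and> \<bar>b\<bar> = 8"
    by blast
  then show ?thesis
    by auto
qed

lemma odd_iff_mod_4: "odd (m :: nat) \<longleftrightarrow> m mod 4 = 1 \<or> m mod 4 = 3"
  by presburger

lemma even_mod_4: "even (m :: nat) \<Longrightarrow> m mod 4 = 0 \<or> m mod 4 = 2"
  by presburger

lemma card_eq_sum_of_bool:
  assumes "finite A"
  shows "(of_nat (card {x\<in>A. P x}) :: 'b :: semiring_1) = (\<Sum>x\<in>A. of_bool (P x))"
  using assms by (simp add: Int_def)

context coordinatized_code
begin

definition residue_count :: "nat \<Rightarrow> nat" where
  "residue_count p = card {c\<in>C. weight c mod 4 = p}"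

lemma Re_Im_gauss_sum:
  "Re gauss_sum = of_int (int (residue_count 0) - int (residue_count 2))"
  "Im gauss_sum = of_int (int (residue_count 1) - int (residue_count 3))"
  unfolding gauss_sum_def Re_sum Im_sum Re_Im_i_power sum_subtractf residue_count_def
  by (simp_all add: card_eq_sum_of_bool finite_code del: sum_of_bool_eq)

lemma residue_count_norm:
  "gauss_sum * cnj gauss_sum = of_int ((int (residue_count 0) - int (residue_count 2))\<^sup>2
     + (int (residue_count 1) - int (residue_count 3))\<^sup>2)"
  unfolding complex_mult_cnj Re_Im_gauss_sum by simp

lemma residue_count_squares:
  assumes "radical = {0\<^sub>v n}"
  shows "(int (residue_count 0) - int (residue_count 2))\<^sup>2
     + (int (residue_count 1) - int (residue_count 3))\<^sup>2 = int (card C)"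
proof -
  have "gauss_sum * cnj gauss_sum = of_int (int (card C))"
    using gauss_sum_norm unfolding assms by simp
  then show ?thesis
    unfolding residue_count_norm of_int_eq_iff .
qed

lemma sum_mod_4_function:
  "(\<Sum>c\<in>C. f (weight c mod 4)) = f 0 * residue_count 0 + f 1 * residue_count 1
     + f 2 * residue_count 2 + f 3 * residue_count 3"
proof -
  have "(\<Sum>c\<in>C. f (weight c mod 4)) = (\<Sum>c\<in>C. f 0 * of_bool (weight c mod 4 = 0)
     + f 1 * of_bool (weight c mod 4 = 1) + f 2 * of_bool (weight c mod 4 = 2)
     + f 3 * of_bool (weight c mod 4 = 3))"
  proof (rule sum.cong)
    fix c
    have "weight c mod 4 \<in> {0, 1, 2, 3}"
      by auto
    then show "f (weight c mod 4) = f 0 * of_bool (weight c mod 4 = 0)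
     + f 1 * of_bool (weight c mod 4 = 1) + f 2 * of_bool (weight c mod 4 = 2)
     + f 3 * of_bool (weight c mod 4 = 3)"
      by auto
  qed simp
  also have "\<dots> = f 0 * residue_count 0 + f 1 * residue_count 1
     + f 2 * residue_count 2 + f 3 * residue_count 3"
    unfolding sum.distrib sum_distrib_left[symmetric] residue_count_def
    using card_eq_sum_of_bool[OF finite_code, where 'b = nat] by simp
  finally show ?thesis .
qed

lemma residue_count_sum:
  "residue_count 0 + residue_count 1 + residue_count 2 + residue_count 3 = card C"
  using sum_mod_4_function[of "\<lambda>_. 1"] by simp

lemma odd_residue_count:
  "2 * (residue_count 1 + residue_count 3) = (if \<forall>c\<in>C. even (weight c) then 0 else card C)"
proof -
  have "{c\<in>C. (of_nat (weight c) :: bit) = 1}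
      = {c\<in>C. weight c mod 4 = 1} \<union> {c\<in>C. weight c mod 4 = 3}"
  proof -
    have "(of_nat (weight c) :: bit) = 1 \<longleftrightarrow> weight c mod 4 = 1 \<or> weight c mod 4 = 3" for c
    proof -
      have "(of_nat (weight c) :: bit) = 1 \<longleftrightarrow> odd (weight c)"
        using of_nat_bit_eq_0_iff[of "weight c"] by auto
      also have "\<dots> \<longleftrightarrow> weight c mod 4 = 1 \<or> weight c mod 4 = 3"
        by (rule odd_iff_mod_4)
      finally show ?thesis .
    qed
    then show ?thesis by auto
  qed
  moreover have "card ({c\<in>C. weight c mod 4 = 1} \<union> {c\<in>C. weight c mod 4 = 3})
      = residue_count 1 + residue_count 3"
    unfolding residue_count_def using finite_code by (intro card_Un_disjoint) auto
  ultimately show ?thesis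
    using card_one[OF parity_linear] by (simp add: of_nat_bit_eq_0_iff)
qed

text \<open>Double counting: each coordinate contributes the number of words at which both it and
  \<psi> are 1, a multiple of 64 / 4 by \<open>card_one_one\<close>.\<close>

lemma sum_weight_hyperplane:
  assumes "linear_form \<psi>" "card C = 64"
  shows "16 dvd (\<Sum>c | c \<in> C \<and> \<psi> c = 1. weight c)"
proof -
  let ?T = "{c \<in> C. \<psi> c = 1}"
  have "(\<Sum>c\<in>?T. weight c) = (\<Sum>c\<in>?T. \<Sum>i\<in>I. of_bool (\<phi> i c = 1))"
    unfolding weight_def using card_eq_sum_of_bool[OF finite_index, where 'b = nat] by simp
  also have "\<dots> = (\<Sum>i\<in>I. \<Sum>c\<in>?T. of_bool (\<phi> i c = 1))"
    by (rule sum.swap)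
  also have "16 dvd \<dots>"
  proof (rule dvd_sum)
    fix i assume "i \<in> I"
    have "(\<Sum>c\<in>?T. of_bool (\<phi> i c = 1)) = card {c\<in>?T. \<phi> i c = 1}"
      using card_eq_sum_of_bool[of ?T, where 'b = nat] finite_code by simp
    also have "\<dots> = card {c\<in>C. \<psi> c = 1 \<and> \<phi> i c = 1}"
      by (rule arg_cong[where f = card]) auto
    also have "16 dvd \<dots>"
      using card_one_one[OF assms(1) linear[OF \<open>i \<in> I\<close>]] assms(2) by auto
    finally show "16 dvd (\<Sum>c\<in>?T. of_bool (\<phi> i c = 1) :: nat)" .
  qed
  finally show ?thesis .
qed

text \<open>If all weights are even, half the weight modulo 2 is a quadratic form over the field
  with two elements, with polar form \<open>form\<close>.\<close>

lemma neg_one_power_half_weight_add: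
  assumes even: "\<forall>c\<in>C. even (weight c)" and xy: "x \<in> C" "y \<in> C"
  shows "(-1) ^ (weight (x + y) div 2)
    = (-1) ^ (weight x div 2) * (-1) ^ (weight y div 2) * sign (form x y)"
proof -
  let ?m = "card {i\<in>I. \<phi> i x = 1 \<and> \<phi> i y = 1}"
  obtain a where a: "weight (x + y) = 2 * a"
    using even add_mem[OF xy] by blast
  obtain b where b: "weight x = 2 * b"
    using even xy by blast
  obtain c where c: "weight y = 2 * c"
    using even xy by blast
  note abc = a b c
  have eq: "b + c + ?m = a + (?m + ?m)"
    using weight_add[OF xy] unfolding abc by simp
  have "(-1) ^ b * (-1) ^ c * (-1) ^ ?m = (-1) ^ a * ((-1) ^ ?m * (-1 :: int) ^ ?m)"
    unfolding power_add[symmetric] eq ..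
  also have "(-1) ^ ?m * (-1 :: int) ^ ?m = 1"
    by (simp flip: power_mult_distrib)
  finally show ?thesis
    unfolding abc by (simp add: form_eq_card sign_eq_power)
qed

end

section \<open>Lower bounds for the length\<close>

context coordinatized_code
begin

lemma sum_weight_ge_of_some_odd_weight:
  assumes nondeg: "radical = {0\<^sub>v n}" and card: "card C = 64" and "even d"
    and d: "\<forall>c\<in>C - {0\<^sub>v n}. d \<le> weight c"
    and "\<not> (\<forall>c\<in>C. even (weight c))"
  shows "63 * d + 86 \<le> (\<Sum>c\<in>C. weight c)"
proof -
  \<comment> \<open>For even \<open>d\<close>, the residues of d and -d modulo 4 agree, so
    \<open>f\<close> gives the residue of the excess of a weight over \<open>d\<close>, hence the
    least possible excess.\<close>
  define f where "f p = (p + d) mod 4" for p :: nat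
  have le: "d + f (weight c mod 4) \<le> weight c" if c: "c \<in> C - {0\<^sub>v n}" for c
  proof -
    obtain k where k: "weight c = d + k"
      using d c le_Suc_ex by blast
    obtain e where e: "d = 2 * e"
      using \<open>even d\<close> by blast
    have "(weight c + d) mod 4 = k mod 4"
      unfolding k e by presburger
    then show ?thesis
      unfolding f_def by (simp add: k mod_add_left_eq)
  qed
  let ?N = residue_count
  have "63 * d + (\<Sum>c\<in>C - {0\<^sub>v n}. f (weight c mod 4)) = (\<Sum>c\<in>C - {0\<^sub>v n}. d + f (weight c mod 4))"
    using finite_code card zero_mem by (simp add: sum.distrib)
  also have "\<dots> \<le> (\<Sum>c\<in>C - {0\<^sub>v n}. weight c)"
    using le by (intro sum_mono) blast
  finally have "63 * d + (\<Sum>c\<in>C. f (weight c mod 4)) \<le> (\<Sum>c\<in>C. weight c) + f 0"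
    using finite_code zero_mem by (simp add: sum.remove)
  moreover have "(\<Sum>c\<in>C. f (weight c mod 4)) \<ge> 86 + f 0"
  proof -
    have N: "?N 1 + ?N 3 = 32" "?N 0 + ?N 2 = 32"
      using odd_residue_count residue_count_sum card assms(5) by simp_all
    have "int (?N 0) - int (?N 2) \<in> {-8, 8} \<and> int (?N 1) - int (?N 3) = 0
        \<or> int (?N 0) - int (?N 2) = 0 \<and> int (?N 1) - int (?N 3) \<in> {-8, 8}"
      using residue_count_squares[OF nondeg] card by (intro sum_two_squares_eq_64) simp
    \<comment> \<open>In each case the two classes of one parity have 16 words each and those of the
      other parity have 20 and 12, which makes both sums at least 88. The zero word accounts for
      \<open>f 0\<close>, at most 2, and 86 remain.\<close>
    with N have "?N 1 + 2 * ?N 2 + 3 * ?N 3 \<ge> 88" "2 * ?N 0 + 3 * ?N 1 + ?N 3 \<ge> 88"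
      by auto
    moreover have "d mod 4 = 0 \<or> d mod 4 = 2"
      using \<open>even d\<close> by (rule even_mod_4)
    then have "f 0 = 0 \<and> f 1 = 1 \<and> f 2 = 2 \<and> f 3 = 3 \<or> f 0 = 2 \<and> f 1 = 3 \<and> f 2 = 0 \<and> f 3 = 1"
      unfolding f_def mod_add_right_eq[of _ d, symmetric] by auto
    ultimately show ?thesis
      unfolding sum_mod_4_function by auto
  qed
  ultimately show ?thesis
    by linarith
qed

text \<open>If the sum of the weights were smaller, then the excesses \<^term>\<open>(weight c - d) div 4\<close> would
  form a multiset of at most six words.  The divisibility of the weight sums over hyperplane
  complements by 16 transfers the quadratic form \<^term>\<open>weight c div 2 mod 2\<close> to this multiset, which is
  impossible since an even multiset of six points cannot carry a nondegenerate form of rank six.\<close>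

lemma sum_weight_ge_of_all_weights_even:
  assumes nondeg: "radical = {0\<^sub>v n}" and card: "card C = 64" and "even d"
    and d: "\<forall>c\<in>C - {0\<^sub>v n}. d \<le> weight c"
    and even: "\<forall>c\<in>C. even (weight c)"
  shows "63 * d + 82 \<le> (\<Sum>c\<in>C. weight c)"
proof (rule ccontr)
  assume small: "\<not> ?thesis"
  let ?N = residue_count
  \<comment> \<open>As \<open>d\<close> is even, \<open>r c\<close> is the residue of the excess
    over \<open>d\<close> for nonzero \<open>c\<close>. At the zero word the subtraction in
    \<open>g\<close> truncates, so \<open>g\<close> vanishes there.\<close>
  define r where "r c = (weight c + d) mod 4" for c
  define g where "g c = (weight c - d) div 4" for c
  define q :: "bit vec \<Rightarrow> int" where "q c = (-1) ^ (weight c div 2)" for c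
  define S where "S = (\<Sum>c\<in>C. q c)"
  have d4: "d mod 4 = 0 \<or> d mod 4 = 2"
    using \<open>even d\<close> by (rule even_mod_4)
  have w4: "weight c mod 4 = 0 \<or> weight c mod 4 = 2" if "c \<in> C" for c
    using even even_mod_4 that by blast
  have q_iff: "q c = 1 \<and> weight c mod 4 = 0 \<or> q c = -1 \<and> weight c mod 4 = 2" if c: "c \<in> C" for c
  proof -
    have "m mod 4 = 0 \<and> even (m div 2) \<or> m mod 4 = 2 \<and> odd (m div 2)"
      if "m mod 4 = 0 \<or> m mod 4 = 2" for m :: nat
      using that by presburger
    from this[OF w4[OF c]]
    have "weight c mod 4 = 0 \<and> even (weight c div 2) \<or> weight c mod 4 = 2 \<and> odd (weight c div 2)" .
    then show ?thesis
      unfolding q_def by auto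
  qed
  have N: "?N 1 = 0" "?N 3 = 0" "?N 0 + ?N 2 = 64"
    using odd_residue_count residue_count_sum card even by simp_all
  have S_N: "S = int (?N 0) - int (?N 2)"
  proof -
    have "S = (\<Sum>c\<in>C. of_bool (weight c mod 4 = 0) - of_bool (weight c mod 4 = 2))"
      unfolding S_def
    proof (intro sum.cong refl)
      fix c assume "c \<in> C"
      then show "q c = of_bool (weight c mod 4 = 0) - of_bool (weight c mod 4 = 2)"
        using q_iff[of c] by auto
    qed
    also have "\<dots> = int (?N 0) - int (?N 2)"
      unfolding sum_subtractf residue_count_def
      using card_eq_sum_of_bool[OF finite_code, where 'b = int] by simp
    finally show ?thesis .
  qed
  have "S\<^sup>2 + 0\<^sup>2 = 64"
    using residue_count_squares[OF nondeg] card N by (simp add: S_N)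
  then have S: "S = 8 \<or> S = -8"
    using sum_two_squares_eq_64[of S 0] by auto
  \<comment> \<open>On \<open>C\<close> the values of \<open>r\<close> are 0 and 2; the sign
    \<epsilon> makes \<open>r\<close> an affine function of \<open>q\<close>, so that sums of
    \<open>r\<close> follow from Gauss sums.\<close>
  define \<epsilon> :: int where "\<epsilon> = (if d mod 4 = 0 then -1 else 1)"
  have r_mod: "r c = (weight c mod 4 + d mod 4) mod 4" for c
    by (simp add: r_def mod_add_eq)
  have r_q: "int (r c) = 1 + \<epsilon> * q c" if "c \<in> C" for c
    using q_iff[OF that] d4 unfolding r_mod \<epsilon>_def by auto
  have decomp: "weight c = d + r c + 4 * g c" if c: "c \<in> C - {0\<^sub>v n}" for c
  proof -
    obtain k where k: "weight c = d + k"
      using d c le_Suc_ex by blast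
    obtain e where e: "d = 2 * e"
      using \<open>even d\<close> by blast
    have "(weight c + d) mod 4 = k mod 4"
      unfolding k e by presburger
    then show ?thesis
      unfolding r_def g_def by (simp add: k)
  qed
  have g0: "g (0\<^sub>v n) = 0"
    by (simp add: g_def)

  define P where "P = {c\<in>C. g c > 0}"
  have finP: "finite P"
    using finite_code by (simp add: P_def)
  have sum_g: "sum g P \<le> 6"
  proof -
    have "(\<Sum>c\<in>C. weight c) = (\<Sum>c\<in>C - {0\<^sub>v n}. weight c)"
      using finite_code zero_mem by (simp add: sum.remove)
    also have "\<dots> = (\<Sum>c\<in>C - {0\<^sub>v n}. d + r c + 4 * g c)"
      using decomp by (intro sum.cong) auto
    also have "\<dots> = 63 * d + (\<Sum>c\<in>C - {0\<^sub>v n}. r c) + 4 * (\<Sum>c\<in>C - {0\<^sub>v n}. g c)"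
      using finite_code card zero_mem by (simp add: sum.distrib sum_distrib_left)
    finally have "63 * d + (\<Sum>c\<in>C. r c) + 4 * (\<Sum>c\<in>C. g c) = (\<Sum>c\<in>C. weight c) + r (0\<^sub>v n)"
      using finite_code zero_mem g0 by (simp add: sum.remove)
    moreover have "54 + r (0\<^sub>v n) \<le> (\<Sum>c\<in>C. r c)"
    proof -
      have N2: "28 \<le> ?N 2" "28 \<le> ?N 0"
        using S S_N N by auto
      have "(\<Sum>c\<in>C. r c) = (\<Sum>c\<in>C. (weight c mod 4 + d) mod 4)"
        unfolding r_def by (simp add: mod_add_left_eq)
      also have "\<dots> = (0 + d) mod 4 * ?N 0 + (1 + d) mod 4 * ?N 1 + (2 + d) mod 4 * ?N 2 + (3 + d) mod 4 * ?N 3"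
        by (rule sum_mod_4_function)
      also have "\<dots> = d mod 4 * ?N 0 + (2 + d) mod 4 * ?N 2"
        using N by simp
      finally have *: "(\<Sum>c\<in>C. r c) = d mod 4 * ?N 0 + (2 + d) mod 4 * ?N 2" .
      from d4 show ?thesis
      proof
        assume 0: "d mod 4 = 0"
        then have "(2 + d) mod 4 = 2" by presburger
        then show ?thesis
          using * 0 N2 by (simp add: r_def)
      next
        assume 2: "d mod 4 = 2"
        then have "(2 + d) mod 4 = 0" by presburger
        then show ?thesis
          using * 2 N2 by (simp add: r_def)
      qed
    qed
    ultimately have "(\<Sum>c\<in>C. g c) \<le> 6"
      using small by linarith
    then show ?thesis
      using sum_mono2[of C P g] finite_code by (auto simp: P_def)
  qed

  define G where "G z = (\<Sum>c | c \<in> C \<and> form z c = 1. g c)" for z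
  \<comment> \<open>The total weight of the words not orthogonal to \<open>z\<close> is divisible by
    16, as is the contribution of \<open>d\<close> to it. The contribution of \<open>r\<close> is
    known from the Gauss sum, so \<open>4 * G z\<close> is determined modulo 16.\<close>
  have G_mod: "G z mod 4 = weight z mod 4" if z: "z \<in> C" for z
  proof -
    let ?T = "{c \<in> C. form z c = 1}"
    have lin: "linear_form (form z)"
      by (rule form_linear[OF z])
    have T0: "?T \<subseteq> C - {0\<^sub>v n}"
      using linear_form_zero[OF lin] by auto
    have finT: "finite ?T"
      using finite_code by simp
    have cardT: "card ?T = 0 \<or> card ?T = 32"
      using card_one[OF lin] card by (auto split: if_splits)
    \<comment> \<open>Twisting by \<open>sign (form z c)\<close> amounts to translating by
      \<open>z\<close>: the twisted Gauss sum is \<open>q z * S\<close>.\<close>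
    have qT: "2 * (\<Sum>c\<in>?T. q c) = S * (1 - q z)"
    proof -
      have "(\<Sum>c\<in>C. q c * sign (form z c)) = (\<Sum>c\<in>C. q z * q (c + z))"
      proof (intro sum.cong refl)
        fix c assume c: "c \<in> C"
        have "q z * q (c + z) = (q z * q z) * (q c * sign (form z c))"
          using neg_one_power_half_weight_add[OF even c z] by (simp add: q_def form_sym)
        moreover have "q z * q z = 1"
          using q_iff[OF z] by auto
        ultimately show "q c * sign (form z c) = q z * q (c + z)"
          by simp
      qed
      also have "\<dots> = q z * S"
        unfolding S_def sum_distrib_left[symmetric] sum_translation[OF z] ..
      finally have twisted: "(\<Sum>c\<in>C. q c * sign (form z c)) = q z * S" .
      have "2 * (\<Sum>c\<in>?T. q c) = 2 * (\<Sum>c\<in>C. if form z c = 1 then q c else 0)"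
        using finite_code by (simp add: sum.If_cases Int_def)
      also have "\<dots> = (\<Sum>c\<in>C. q c - q c * sign (form z c))"
        unfolding sum_distrib_left
      proof (intro sum.cong refl)
        fix c show "2 * (if form z c = 1 then q c else 0) = q c - q c * sign (form z c)"
          by (cases "form z c") simp_all
      qed
      also have "\<dots> = S - q z * S"
        unfolding sum_subtractf twisted S_def ..
      finally show ?thesis
        by (simp add: algebra_simps)
    qed
    obtain R where R: "(\<Sum>c\<in>?T. r c) = R"
      by simp
    have "int R = (\<Sum>c\<in>?T. 1 + \<epsilon> * q c)"
      unfolding R[symmetric] of_nat_sum by (intro sum.cong refl) (simp add: r_q)
    also have "2 * \<dots> = 2 * int (card ?T) + \<epsilon> * (2 * (\<Sum>c\<in>?T. q c))"
      by (simp add: sum.distrib sum_distrib_left algebra_simps)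
    finally have R2: "2 * int R = 2 * int (card ?T) + \<epsilon> * (S * (1 - q z))"
      unfolding qT .
    have "\<epsilon> = 1 \<or> \<epsilon> = -1"
      by (simp add: \<epsilon>_def)
    \<comment> \<open>\<open>R\<close> equals \<open>card ?T\<close> if \<open>q z = 1\<close> and
      differs from it by 8 if \<open>q z = -1\<close>; the value -8 cannot occur for a natural
      number.\<close>
    with R2 S cardT have "q z = 1 \<and> (R = 0 \<or> R = 32) \<or> q z = -1 \<and> (R = 8 \<or> R = 24 \<or> R = 40)"
      using q_iff[OF z] by (elim disjE conjE) auto
    then have rT: "R mod 16 = 4 * (weight z mod 4)"
      using q_iff[OF z] by auto
    have "16 dvd (\<Sum>c\<in>?T. weight c)"
      by (rule sum_weight_hyperplane[OF lin card])
    also have "(\<Sum>c\<in>?T. weight c) = (\<Sum>c\<in>?T. d + r c + 4 * g c)"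
      using decomp T0 by (intro sum.cong) auto
    also have "\<dots> = card ?T * d + R + 4 * G z"
      unfolding G_def R[symmetric] by (simp add: sum.distrib sum_distrib_left)
    finally have "16 dvd (card ?T * d + R + 4 * G z)" .
    moreover have "16 dvd card ?T * d"
      using cardT by auto
    ultimately have dvd: "16 dvd R + 4 * G z"
      by (simp add: add.assoc dvd_add_right_iff)
    \<comment> \<open>Modulo 4 the two hypotheses say that \<open>a + b\<close> is 0, and an even
      residue is its own negative.\<close>
    have mod: "b mod 4 = a mod 4" if "16 dvd R + 4 * b" "R mod 16 = 4 * (a mod 4)" "a mod 4 = 0 \<or> a mod 4 = 2"
      for a b :: nat
    proof -
      have "4 * ((a mod 4 + b) mod 4) = (4 * (a mod 4) + 4 * b) mod 16"
        using mult_mod_right[of 4 "a mod 4 + b" 4] by (simp add: distrib_left)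
      also have "\<dots> = (R + 4 * b) mod 16"
        unfolding that(2)[symmetric] by (rule mod_add_left_eq)
      finally have "(a mod 4 + b) mod 4 = 0"
        using that(1) by simp
      with that(3) show ?thesis
        by (elim disjE) presburger+
    qed
    show ?thesis
      by (rule mod[OF dvd rT w4[OF z]])
  qed

  define F where "F z = {c\<in>P. form z c = 1}" for z
  have G_F: "G z = sum g (F z)" for z
  proof -
    have "G z = sum g {c\<in>C. form z c = 1 \<and> g c > 0}"
      unfolding G_def using finite_code by (intro sum.mono_neutral_right) auto
    also have "{c\<in>C. form z c = 1 \<and> g c > 0} = F z"
      by (auto simp: F_def P_def)
    finally show ?thesis .
  qed
  have P_sub: "P \<subseteq> C"
    by (auto simp: P_def)
  \<comment> \<open>If \<open>z\<close> and \<open>y\<close> have the same image, then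
    \<open>v = z + y\<close> is orthogonal to \<open>P\<close>. Adding \<open>v\<close> then changes
    no value of \<open>F\<close>, hence no weight modulo 4, and polarization puts \<open>v\<close>
    into the radical.\<close>
  have inj: "inj_on F C"
  proof (rule inj_onI)
    fix z y assume z: "z \<in> C" and y: "y \<in> C" and eq: "F z = F y"
    define v where "v = z + y"
    have v: "v \<in> C"
      by (simp add: v_def add_mem z y)
    have form_v: "form v c = 0" if "c \<in> P" for c
    proof -
      have "c \<in> F z \<longleftrightarrow> c \<in> F y"
        by (simp add: eq)
      then have "form z c = form y c"
        using that by (cases "form z c"; cases "form y c") (simp_all add: F_def)
      then show ?thesis
        using linear_form_add[OF form_linear' z y, of c] that P_sub by (auto simp: v_def)
    qed
    have "form x v = 0" if x: "x \<in> C" for x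
    proof -
      have "F v = {}"
        using form_v by (auto simp: F_def)
      then have "weight v mod 4 = 0"
        using G_mod[OF v] by (simp add: G_F)
      have "form (x + v) c = form x c" if "c \<in> P" for c
        using linear_form_add[OF form_linear' x v, of c] form_v[OF that] that P_sub by auto
      then have "F (x + v) = F x"
        by (auto simp: F_def)
      then have "weight (x + v) mod 4 = weight x mod 4"
        using G_mod[OF add_mem[OF x v]] G_mod[OF x] by (simp add: G_F)
      have even: "even m" if "a mod 4 = b mod 4" "e mod 4 = 0" "a + 2 * m = b + e" for a b e m :: nat
        using that by presburger
      have "even (card {i\<in>I. \<phi> i x = 1 \<and> \<phi> i v = 1})"
        by (rule even[OF \<open>weight (x + v) mod 4 = weight x mod 4\<close> \<open>weight v mod 4 = 0\<close> weight_add[OF x v]])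
      then show ?thesis
        by (simp add: form_eq_card of_nat_bit_eq_0_iff)
    qed
    then have "v \<in> radical"
      by (simp add: radical_def v)
    then have "z + y = 0\<^sub>v n"
      using nondeg by (simp add: v_def)
    then have "z = 0\<^sub>v n + y"
      using add_cancel[OF z y] by simp
    then show "z = y"
      using y carrier by auto
  qed
  have image: "F ` C \<subseteq> Pow P"
    by (auto simp: F_def)
  have "card (F ` C) = 64"
    using card card_image[OF inj] by simp
  have "(64 :: nat) \<le> 2 ^ card P"
    using card_mono[OF _ image] \<open>card (F ` C) = 64\<close> finP by (simp add: card_Pow)
  then have "(2 :: nat) ^ 6 \<le> 2 ^ card P"
    by simp
  then have "6 \<le> card P"
    using power_le_imp_le_exp[of "2 :: nat" 6 "card P"] by simp
  moreover have "card P \<le> sum g P"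
    using sum_mono[of P "\<lambda>_. 1" g] by (auto simp: P_def)
  ultimately have cardP: "card P = 6" "sum g P = card P"
    using sum_g by linarith+
  have g1: "g c = 1" if c: "c \<in> P" for c
  proof -
    have "sum g (P - {c}) \<ge> card (P - {c})"
      using sum_mono[of "P - {c}" "\<lambda>_. 1" g] by (auto simp: P_def)
    moreover have "sum g P = g c + sum g (P - {c})" "card P = 1 + card (P - {c})"
      using finP c by (simp_all add: sum.remove card.remove del: card_Diff_insert card_Diff_singleton)
    moreover have "g c > 0"
      using c by (simp add: P_def)
    ultimately show ?thesis
      using cardP by linarith
  qed
  have "F ` C = Pow P"
    using \<open>card (F ` C) = 64\<close> cardP finP image by (intro card_subset_eq) (simp_all add: card_Pow)
  obtain c where c: "c \<in> P"
    using cardP by fastforce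
  then have "{c} \<in> F ` C"
    using \<open>F ` C = Pow P\<close> by blast
  then obtain z where z: "z \<in> C" "F z = {c}"
    by auto
  then have "G z = 1"
    using g1[OF c] by (simp add: G_F)
  then have "weight z mod 4 = 1"
    using G_mod[OF z(1)] by simp
  then show False
    using w4[OF z(1)] by simp
qed

end

section \<open>Averaging bounds and the parity extension\<close>

lemma of_nat_bit_eq_1_iff: "(of_nat m :: bit) = 1 \<longleftrightarrow> odd m"
  using of_nat_bit_eq_0_iff[of m] by (cases "of_nat m :: bit") simp_all

lemma bit_add_eq_0_iff: "(a :: bit) + b = 0 \<longleftrightarrow> a = b"
  by (cases a; cases b) simp_all

lemma mod_4_imp_even: "(m :: nat) mod 4 = 0 \<Longrightarrow> even m" "m mod 4 = 2 \<Longrightarrow> even m"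
  by presburger+

lemma square_int_neq_32: "(a :: int)\<^sup>2 \<noteq> 32"
proof -
  have "a\<^sup>2 \<le> 5\<^sup>2 \<or> 6\<^sup>2 \<le> a\<^sup>2"
    unfolding abs_le_square_iff[symmetric] by simp linarith
  then show ?thesis
    by auto
qed

lemma add_mod_2_mono: "(d :: nat) \<le> m \<Longrightarrow> d + d mod 2 \<le> m + m mod 2"
  using mod_less_divisor[of 2 d] by (cases "d = m") simp_all

context coordinatized_code
begin

text \<open>A nonvanishing form is 1 on exactly half of the words; inequality is all that holds
  because forms of the family may vanish on \<open>C\<close>, as the parity check of an even code
  does.\<close>

lemma sum_weight_le: "2 * (\<Sum>c\<in>C. weight c) \<le> card C * card I"
proof -
  have "(\<Sum>c\<in>C. weight c) = (\<Sum>c\<in>C. \<Sum>i\<in>I. of_bool (\<phi> i c = 1))"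
    unfolding weight_def using card_eq_sum_of_bool[OF finite_index, where 'b = nat] by simp
  also have "\<dots> = (\<Sum>i\<in>I. \<Sum>c\<in>C. of_bool (\<phi> i c = 1))"
    by (rule sum.swap)
  also have "\<dots> = (\<Sum>i\<in>I. card {c\<in>C. \<phi> i c = 1})"
    using card_eq_sum_of_bool[OF finite_code, where 'b = nat] by simp
  finally have "2 * (\<Sum>c\<in>C. weight c) = (\<Sum>i\<in>I. 2 * card {c\<in>C. \<phi> i c = 1})"
    by (simp add: sum_distrib_left)
  also have "\<dots> \<le> (\<Sum>i\<in>I. card C)"
    by (intro sum_mono) (simp add: card_one[OF linear])
  finally show ?thesis
    by (simp add: mult.commute)
qed

text \<open>\<open>D\<close> holds the words exempt from the weight bound: the zero word for a code
  itself, and all words that become zero for a residual code.\<close>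

lemma card_times_le_sum_weight:
  assumes "\<forall>c\<in>C - D. b \<le> weight c" "finite D" "card D \<le> k"
  shows "card C * b \<le> (\<Sum>c\<in>C. weight c) + k * b"
proof -
  have "card C \<le> card (C - D) + card (C \<inter> D)"
    using card_Diff_subset_Int[of C D] finite_code by simp
  also have "card (C \<inter> D) \<le> card D"
    using assms(2) by (intro card_mono) auto
  finally have "card C * b \<le> (card (C - D) + k) * b"
    using assms(3) by (intro mult_right_mono) auto
  also have "card (C - D) * b \<le> (\<Sum>c\<in>C - D. weight c)"
    using sum_bounded_below[of "C - D" b weight] assms(1) by simp
  then have "(card (C - D) + k) * b \<le> (\<Sum>c\<in>C - D. weight c) + k * b"
    by (simp add: distrib_right)
  also have "(\<Sum>c\<in>C - D. weight c) \<le> (\<Sum>c\<in>C. weight c)"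
    using finite_code by (intro sum_mono2) auto
  finally show ?thesis
    by simp
qed

definition parity_coordinate :: "'i option \<Rightarrow> bit vec \<Rightarrow> bit" where
  "parity_coordinate j c = (case j of None \<Rightarrow> of_nat (weight c) | Some i \<Rightarrow> \<phi> i c)"

lemma parity_extension: "coordinatized_code n C (insert None (Some ` I)) parity_coordinate"
proof
  show "finite (insert None (Some ` I))"
    using finite_index by simp
  show "linear_form (parity_coordinate j)" if "j \<in> insert None (Some ` I)" for j
    using that linear parity_linear by (auto simp: parity_coordinate_def[abs_def])
qed

lemma weight_parity_extension:
  "coordinatized_code.weight (insert None (Some ` I)) parity_coordinate c = weight c + weight c mod 2"
proof -
  interpret ext: coordinatized_code n C "insert None (Some ` I)" parity_coordinate
    by (rule parity_extension)
  have "{j \<in> insert None (Some ` I). parity_coordinate j c = 1}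
      = (if odd (weight c) then {None} else {}) \<union> Some ` {i\<in>I. \<phi> i c = 1}"
    by (auto simp: parity_coordinate_def of_nat_bit_eq_1_iff)
  moreover have "card (Some ` {i\<in>I. \<phi> i c = 1}) = weight c"
    unfolding weight_def by (intro card_image) simp
  ultimately show ?thesis
    unfolding ext.weight_def using finite_index by (simp add: mod_2_eq_odd card_insert_if image_iff)
qed

lemma form_parity_extension:
  "coordinatized_code.form (insert None (Some ` I)) parity_coordinate x y
    = of_nat (weight x) * of_nat (weight y) + form x y"
proof -
  interpret ext: coordinatized_code n C "insert None (Some ` I)" parity_coordinate
    by (rule parity_extension)
  show ?thesis
    unfolding ext.form_def form_def using finite_index
    by (simp add: sum.reindex parity_coordinate_def)
qed

lemma even_weights_code: "binary_code n {c\<in>C. even (weight c)}"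
proof
  show "x + y \<in> {c\<in>C. even (weight c)}" if "x \<in> {c\<in>C. even (weight c)}" "y \<in> {c\<in>C. even (weight c)}" for x y
  proof -
    have "(of_nat (weight (x + y)) :: bit) = of_nat (weight x) + of_nat (weight y)"
      using that by (intro linear_form_add[OF parity_linear]) auto
    moreover have "of_nat (weight x) = (0 :: bit)" "of_nat (weight y) = (0 :: bit)"
      using that unfolding of_nat_bit_eq_0_iff by blast+
    ultimately show ?thesis
      using that add_mem by (simp add: of_nat_bit_eq_0_iff)
  qed
qed (use carrier zero_mem in auto)

lemma even_weights_coordinatized: "coordinatized_code n {c\<in>C. even (weight c)} I \<phi>"
proof (intro coordinatized_code.intro even_weights_code coordinatized_code_axioms.intro finite_index)
  show "binary_code.linear_form {c\<in>C. even (weight c)} (\<phi> i)" if "i \<in> I" for i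
    using linear[OF that] unfolding linear_form_def binary_code.linear_form_def[OF even_weights_code]
    by blast
qed

text \<open>The orthogonal complement of a word \<open>z\<close> as below is the subcode of even words.  This has 32
  elements and is nondegenerate, although the Gauss sum of an even nondegenerate code is an integer
  whose square is the size of the code.\<close>

lemma no_characteristic_word:
  assumes nondeg: "radical = {0\<^sub>v n}" and card: "card C = 64" and zC: "z \<in> C" and odd: "odd (weight z)"
    and form_z: "\<And>c. c \<in> C \<Longrightarrow> form c z = of_nat (weight c)"
  shows False
proof -
  have par_z: "(of_nat (weight z) :: bit) = 1"
    using odd by (simp add: of_nat_bit_eq_1_iff)
  define C0 where "C0 = {c\<in>C. even (weight c)}"
  interpret E: coordinatized_code n C0 I \<phi>
    unfolding C0_def by (rule even_weights_coordinatized)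
  \<comment> \<open>Every odd word is \<open>z\<close> plus an even word, and \<open>z\<close> is
    orthogonal to all even words, so orthogonality to the even subcode extends to
    \<open>C\<close>.\<close>
  have "E.radical \<subseteq> radical"
  proof
    fix v assume "v \<in> E.radical"
    then have v: "v \<in> C0" and orth: "form c v = 0" if "c \<in> C0" for c
      using that by (auto simp: E.radical_def)
    \<comment> \<open>The \<open>if\<close> clause above also guards the membership of
      \<open>v\<close>; the zero word discharges it.\<close>
    note v = v[OF E.zero_mem]
    have vC: "v \<in> C" and even_v: "(of_nat (weight v) :: bit) = 0"
      using v by (auto simp: C0_def of_nat_bit_eq_0_iff)
    have "form c v = 0" if c: "c \<in> C" for c
    proof (cases "even (weight c)")
      case True
      then show ?thesis
        using orth c by (simp add: C0_def)
    next
      case False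
      then have "(of_nat (weight c) :: bit) = 1"
        by (simp add: of_nat_bit_eq_1_iff)
      then have "(of_nat (weight (c + z)) :: bit) = 0"
        using linear_form_add[OF parity_linear c zC] par_z by simp
      then have "c + z \<in> C0"
        using add_mem[OF c zC] by (simp add: C0_def of_nat_bit_eq_0_iff)
      then have "form c v + form z v = 0"
        using orth linear_form_add[OF form_linear'[OF vC] c zC] by simp
      moreover have "form z v = 0"
        using form_z[OF vC] even_v by (simp add: form_sym)
      ultimately show ?thesis
        by simp
    qed
    then show "v \<in> radical"
      by (simp add: radical_def vC)
  qed
  then have "E.radical = {0\<^sub>v n}"
    using nondeg E.zero_mem_radical by auto
  then have sq: "(int (E.residue_count 0) - int (E.residue_count 2))\<^sup>2
      + (int (E.residue_count 1) - int (E.residue_count 3))\<^sup>2 = int (card C0)"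
    by (rule E.residue_count_squares)
  have "E.residue_count 1 = 0" "E.residue_count 3 = 0"
    using E.odd_residue_count by (auto simp: C0_def split: if_splits)
  moreover have "card C0 = 32"
  proof -
    have "E.residue_count 0 = residue_count 0" "E.residue_count 2 = residue_count 2"
      unfolding E.residue_count_def residue_count_def unfolding C0_def
      by (auto intro!: arg_cong[where f = card] dest: mod_4_imp_even)
    moreover have "\<not> (\<forall>c\<in>C. even (weight c))"
      using odd zC by blast
    then have "2 * (residue_count 1 + residue_count 3) = card C"
      unfolding odd_residue_count by (rule if_not_P)
    then have "residue_count 1 + residue_count 3 = 32"
      using card by simp
    ultimately show ?thesis
      using E.residue_count_sum residue_count_sum card
        \<open>E.residue_count 1 = 0\<close> \<open>E.residue_count 3 = 0\<close> by linarith
  qed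
  ultimately have "(int (E.residue_count 0) - int (E.residue_count 2))\<^sup>2 = 32"
    using sq by simp
  then show False
    using square_int_neq_32 by blast
qed

text \<open>For \<open>z\<close> in the new radical, \<open>form c z\<close> is the product of the
  parities of \<open>c\<close> and \<open>z\<close>. If \<open>z\<close> is even, it lies in the old
  radical; if odd, it is a characteristic word.\<close>

lemma radical_parity_extension:
  assumes nondeg: "radical = {0\<^sub>v n}" and card: "card C = 64"
  shows "coordinatized_code.radical C (insert None (Some ` I)) parity_coordinate = {0\<^sub>v n}"
proof -
  interpret ext: coordinatized_code n C "insert None (Some ` I)" parity_coordinate
    by (rule parity_extension)
  have "z = 0\<^sub>v n" if z: "z \<in> ext.radical" for z
  proof -
    have zC: "z \<in> C"
      using z by (simp add: ext.radical_def)
    have form_z: "form c z = of_nat (weight c) * of_nat (weight z)" if c: "c \<in> C" for c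
    proof -
      have "ext.form c z = 0"
        using z c unfolding ext.radical_def by blast
      then show ?thesis
        unfolding form_parity_extension bit_add_eq_0_iff ..
    qed
    show ?thesis
    proof (cases "even (weight z)")
      case True
      then have "z \<in> radical"
        using form_z zC by (simp add: radical_def of_nat_bit_eq_0_iff)
      then show ?thesis
        using nondeg by simp
    next
      case False
      then have "(of_nat (weight z) :: bit) = 1"
        by (simp add: of_nat_bit_eq_1_iff)
      then have "form c z = of_nat (weight c)" if "c \<in> C" for c
        using form_z[OF that] by simp
      then show ?thesis
        using no_characteristic_word[OF nondeg card zC False] by blast
    qed
  qed
  then show ?thesis
    using ext.zero_mem_radical by blast
qed

lemma sum_weight_ge:
  assumes "radical = {0\<^sub>v n}" "card C = 64" "even d" "\<forall>c\<in>C - {0\<^sub>v n}. d \<le> weight c"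
  shows "63 * d + 82 \<le> (\<Sum>c\<in>C. weight c)"
proof (cases "\<forall>c\<in>C. even (weight c)")
  case True
  then show ?thesis
    using sum_weight_ge_of_all_weights_even assms by blast
next
  case False
  then have "63 * d + 86 \<le> (\<Sum>c\<in>C. weight c)"
    using sum_weight_ge_of_some_odd_weight assms by blast
  then show ?thesis
    by simp
qed

lemma card_parity_index: "card (insert None (Some ` I)) = card I + 1"
  using finite_index by (simp add: card_image)

text \<open>The parity extension raises an odd \<open>d\<close> to \<open>d + 1\<close> at the cost
  of one coordinate; the terms \<open>d mod 2\<close> express both parities at once.\<close>

lemma length_ge_of_nondegenerate:
  assumes "radical = {0\<^sub>v n}" "card C = 64" "\<forall>c\<in>C - {0\<^sub>v n}. d \<le> weight c"
  shows "63 * (d + d mod 2) + 82 \<le> 32 * (card I + d mod 2)"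
proof (cases "even d")
  case True
  then show ?thesis
    using sum_weight_ge[OF assms(1,2) True assms(3)] sum_weight_le assms(2) by simp
next
  case False
  interpret ext: coordinatized_code n C "insert None (Some ` I)" parity_coordinate
    by (rule parity_extension)
  have "\<forall>c\<in>C - {0\<^sub>v n}. d + d mod 2 \<le> ext.weight c"
    using assms(3) by (auto simp: weight_parity_extension intro!: add_mod_2_mono)
  then have "63 * (d + d mod 2) + 82 \<le> (\<Sum>c\<in>C. ext.weight c)"
    by (intro ext.sum_weight_ge radical_parity_extension assms(1,2)) simp_all
  moreover have "2 * (\<Sum>c\<in>C. ext.weight c) \<le> 64 * (card I + 1)"
    using ext.sum_weight_le unfolding assms(2) card_parity_index .
  moreover have "d mod 2 = 1"
    using False by presburger
  ultimately show ?thesis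
    by simp
qed

text \<open>The averaging argument of Plotkin, applied to the parity extension if \<open>d\<close>
  is odd.\<close>

lemma length_ge:
  assumes "\<forall>c\<in>C - D. d \<le> weight c" "finite D" "card D \<le> k"
  shows "2 * (card C * (d + d mod 2)) \<le> card C * (card I + d mod 2) + 2 * (k * (d + d mod 2))"
proof (cases "even d")
  case True
  then show ?thesis
    using card_times_le_sum_weight[OF assms] sum_weight_le by simp
next
  case False
  interpret ext: coordinatized_code n C "insert None (Some ` I)" parity_coordinate
    by (rule parity_extension)
  have "\<forall>c\<in>C - D. d + d mod 2 \<le> ext.weight c"
    using assms(1) by (auto simp: weight_parity_extension intro!: add_mod_2_mono)
  then have "card C * (d + d mod 2) \<le> (\<Sum>c\<in>C. ext.weight c) + k * (d + d mod 2)"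
    using assms(2,3) by (rule ext.card_times_le_sum_weight)
  moreover have "2 * (\<Sum>c\<in>C. ext.weight c) \<le> card C * (card I + 1)"
    using ext.sum_weight_le unfolding card_parity_index .
  moreover have "d mod 2 = 1"
    using False by presburger
  ultimately show ?thesis
    by simp
qed

section \<open>Residual codes\<close>

lemma restrict_index: "J \<subseteq> I \<Longrightarrow> coordinatized_code n C J \<phi>"
  by unfold_locales (use linear finite_index finite_subset in auto)

text \<open>Outside the support of \<open>a\<close> the words \<open>c\<close> and
  \<open>c + a\<close> agree, and at each position of the support exactly one of them is 1. So if
  both weigh at least \<open>weight a\<close>, then \<open>c\<close> keeps at least half of that
  outside.\<close>

lemma weight_residual:
  assumes "a \<in> C" "c \<in> C"
  shows "weight c + weight (c + a) = weight a + 2 * card {i\<in>{i\<in>I. \<phi> i a = 0}. \<phi> i c = 1}"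
proof -
  let ?X = "{i\<in>I. \<phi> i c = 1 \<and> \<phi> i a = 1}" and ?Y = "{i\<in>{i\<in>I. \<phi> i a = 0}. \<phi> i c = 1}"
  have "{i\<in>I. \<phi> i c = 1} = ?X \<union> ?Y"
    using bit_not_one_iff by auto
  then have "weight c = card (?X \<union> ?Y)"
    unfolding weight_def by simp
  also have "\<dots> = card ?X + card ?Y"
    using finite_index by (intro card_Un_disjoint) auto
  finally show ?thesis
    using weight_add[OF assms(2,1)] by linarith
qed

lemma card_zero_coordinates: "card {i\<in>I. \<phi> i a = 0} + weight a = card I"
proof -
  have "card I = card ({i\<in>I. \<phi> i a = 0} \<union> {i\<in>I. \<phi> i a = 1})"
    using bit_not_one_iff by (intro arg_cong[where f = card]) auto
  also have "\<dots> = card {i\<in>I. \<phi> i a = 0} + weight a"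
    unfolding weight_def using finite_index by (intro card_Un_disjoint) auto
  finally show ?thesis ..
qed

text \<open>Two residual steps: shortening at a word of minimum weight, and then at a word of minimum
  weight of the residual code, leads to a four-dimensional code whose weights are at least the odd
  number \<open>2 * m + 1\<close>; it is too short by the Plotkin bound for its parity extension.\<close>

lemma length_ge_of_min_weight_2_mod_8:
  assumes card: "card C = 64" and d: "\<forall>c\<in>C - {0\<^sub>v n}. 8 * m + 2 \<le> weight c"
  shows "63 * m + 23 \<le> 4 * card I"
proof (rule ccontr)
  assume short: "\<not> ?thesis"
  \<comment> \<open>Otherwise the bound \<open>8 * m + 3\<close>, being odd, becomes
    \<open>8 * m + 4\<close> in the parity extension, and averaging contradicts the length. The next
    step down likewise rules out \<open>4 * m + 2\<close>, by averaging alone.\<close>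
  have "\<exists>a\<in>C - {0\<^sub>v n}. weight a = 8 * m + 2"
  proof (rule ccontr)
    assume no: "\<not> ?thesis"
    have "\<forall>c\<in>C - {0\<^sub>v n}. 8 * m + 3 \<le> weight c"
    proof
      fix c assume c: "c \<in> C - {0\<^sub>v n}"
      have "8 * m + 2 \<le> weight c" "weight c \<noteq> 8 * m + 2"
        using d no c by blast+
      then show "8 * m + 3 \<le> weight c"
        by linarith
    qed
    from length_ge[OF this, of 1] show False
      using short card by simp
  qed
  then obtain a where a: "a \<in> C" "a \<noteq> 0\<^sub>v n" "weight a = 8 * m + 2"
    by auto
  define J where "J = {i\<in>I. \<phi> i a = 0}"
  interpret J: coordinatized_code n C J \<phi>
    by (rule restrict_index) (simp add: J_def)
  have J_weight: "weight c + weight (c + a) = weight a + 2 * J.weight c" if "c \<in> C" for c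
    using weight_residual[OF a(1) that] unfolding J.weight_def unfolding J_def .
  have card_J: "card J + (8 * m + 2) = card I"
    using card_zero_coordinates[of a] a by (simp add: J_def)
  have add_nonzero: "c + a \<noteq> 0\<^sub>v n" if "c \<in> C" "a \<in> C" "c \<noteq> a" for c a
  proof
    assume "c + a = 0\<^sub>v n"
    then have "c = 0\<^sub>v n + a"
      using add_cancel[OF that(1,2)] by simp
    then show False
      using that carrier by auto
  qed
  have J_ge: "4 * m + 1 \<le> J.weight c" if "c \<in> C" "c \<noteq> 0\<^sub>v n" "c \<noteq> a" for c
  proof -
    have "8 * m + 2 \<le> weight c" "8 * m + 2 \<le> weight (c + a)"
      using d that add_mem[OF that(1) a(1)] add_nonzero[OF that(1) a(1)] by auto
    then show ?thesis
      using J_weight[OF that(1)] a(3) by linarith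
  qed
  have "\<exists>b\<in>C - {0\<^sub>v n, a}. J.weight b = 4 * m + 1"
  proof (rule ccontr)
    assume no: "\<not> ?thesis"
    have "\<forall>c\<in>C - {0\<^sub>v n, a}. 4 * m + 2 \<le> J.weight c"
    proof
      fix c assume c: "c \<in> C - {0\<^sub>v n, a}"
      have "J.weight c \<noteq> 4 * m + 1"
        using no c by blast
      moreover have "4 * m + 1 \<le> J.weight c"
        using J_ge c by auto
      ultimately show "4 * m + 2 \<le> J.weight c"
        by linarith
    qed
    from J.length_ge[OF this, of 2] show False
      using short card card_J a(2) by (simp add: card_insert_if)
  qed
  then obtain b where b: "b \<in> C" "b \<noteq> 0\<^sub>v n" "b \<noteq> a" "J.weight b = 4 * m + 1"
    by auto
  define K where "K = {i\<in>J. \<phi> i b = 0}"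
  interpret K: coordinatized_code n C K \<phi>
    by (rule J.restrict_index) (simp add: K_def)
  have "card K + (4 * m + 1) = card J"
    using J.card_zero_coordinates[of b] b by (simp add: K_def)
  have "\<forall>c\<in>C - {0\<^sub>v n, a, b, a + b}. 2 * m + 1 \<le> K.weight c"
  proof
    fix c assume c: "c \<in> C - {0\<^sub>v n, a, b, a + b}"
    have "c + b \<noteq> a"
      using add_cancel[of c b] b(1) c by auto
    then have "4 * m + 1 \<le> J.weight c" "4 * m + 1 \<le> J.weight (c + b)"
      using J_ge c add_mem[of c b] b(1) add_nonzero[of c b] by auto
    then show "2 * m + 1 \<le> K.weight c"
      using J.weight_residual[OF b(1), of c] c b(4) unfolding K.weight_def unfolding K_def by auto
  qed
  moreover have "card {0\<^sub>v n, a, b, a + b} \<le> 4"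
    using card_length[of "[0\<^sub>v n, a, b, a + b]"] by simp
  \<comment> \<open>Averaging over the parity extension, with four exceptions among 64 words, gives
    \<open>15 * (m + 1) \<le> 4 * (card K + 1)\<close>. As \<open>card K\<close> is
    \<open>card I - 12 * m - 3\<close>, this is exactly the claimed bound, whence the constant
    23.\<close>
  ultimately show False
    using K.length_ge[of "{0\<^sub>v n, a, b, a + b}" "2 * m + 1" 4] short card card_J
      \<open>card K + (4 * m + 1) = card J\<close> by simp
qed

end

section \<open>Length bounds for linear codes of dimension six\<close>

lemma (in binary_code) coordinatized_standard: "coordinatized_code n C {..<n} (\<lambda>i c. c $ i)"
proof
  fix i assume i: "i \<in> {..<n}"
  show "linear_form (\<lambda>c. c $ i)"
    unfolding linear_form_def
  proof (intro ballI)
    fix x y assume "x \<in> C" "y \<in> C"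
    then have "dim_vec x = n" "dim_vec y = n"
      using carrier by auto
    then show "(x + y) $ i = x $ i + y $ i"
      using i by simp
  qed
qed simp

locale linear_code_dim_6 =
  fixes n :: nat and C :: "bit vec set"
  assumes linear_code: "linear_code n 6 C"
begin

sublocale binary_code n C
  using linear_code by (simp add: linear_code_iff)

sublocale coordinatized_code n C "{..<n}" "\<lambda>i c. c $ i"
  by (rule coordinatized_standard)

lemma card_code: "card C = 64"
  using linear_code by (simp add: linear_code_iff)

lemma weight_eq_hamming_weight: "c \<in> C \<Longrightarrow> weight c = hamming_weight c"
  using carrier by (auto simp: weight_def hamming_weight_def intro!: arg_cong[where f = card])

lemma form_eq_scalar_prod:
  assumes "y \<in> C" shows "form x y = x \<bullet> y"
proof -
  have "dim_vec y = n"
    using assms carrier by auto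
  then show ?thesis
    unfolding form_def scalar_prod_def by (simp add: lessThan_atLeast0)
qed

lemma radical_eq: "radical = C \<inter> dual_code n C"
proof (rule Set.set_eqI)
  fix z
  have "z \<in> radical \<longleftrightarrow> z \<in> C \<and> (\<forall>c\<in>C. z \<bullet> c = 0)"
    unfolding radical_def by (simp add: form_sym[of _ z] form_eq_scalar_prod)
  then show "z \<in> radical \<longleftrightarrow> z \<in> C \<inter> dual_code n C"
    using carrier unfolding dual_code_def by blast
qed

lemma LCD_iff: "LCD n C \<longleftrightarrow> radical = {0\<^sub>v n}"
  by (simp add: LCD_def radical_eq)

lemma nonzero_words: "finite (C - {0\<^sub>v n})" "C - {0\<^sub>v n} \<noteq> {}"
proof -
  have "card (C - {0\<^sub>v n}) = 63"
    using card_code zero_mem finite_code by simp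
  then show "C - {0\<^sub>v n} \<noteq> {}"
    by (metis card.empty zero_neq_numeral)
qed (use finite_code in simp)

lemma le_minimum_distance_iff:
  "b \<le> minimum_distance n C \<longleftrightarrow> (\<forall>c\<in>C - {0\<^sub>v n}. b \<le> weight c)"
  using nonzero_words by (simp add: minimum_distance_def weight_eq_hamming_weight)

lemma minimum_distance_le_weight: "\<forall>c\<in>C - {0\<^sub>v n}. minimum_distance n C \<le> weight c"
  using le_minimum_distance_iff by blast

lemma minimum_distance_le_length: "minimum_distance n C \<le> n"
proof -
  obtain c where "c \<in> C - {0\<^sub>v n}"
    using nonzero_words by blast
  then have "minimum_distance n C \<le> weight c"
    using minimum_distance_le_weight by blast
  also have "\<dots> \<le> card {..<n}"
    unfolding weight_def by (intro card_mono) auto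
  finally show ?thesis
    by simp
qed

end

lemma parity_mono: "(b :: nat) \<le> d \<Longrightarrow> 63 * b + 31 * (b mod 2) \<le> 63 * d + 31 * (d mod 2)"
  using mod_less_divisor[of 2 b] by (cases "b = d") simp_all

text \<open>The 31 is 63 - 32: an odd \<open>b\<close> counts as \<open>b + 1\<close>, but with one
  coordinate more. This makes the bound monotone in \<open>b\<close>, so it passes from the minimum
  distance to any smaller value.\<close>

lemma LCD_length_ge:
  assumes "linear_code n 6 C" "LCD n C" "b \<le> minimum_distance n C"
  shows "63 * b + 31 * (b mod 2) + 82 \<le> 32 * n"
proof -
  interpret linear_code_dim_6 n C
    by unfold_locales (rule assms(1))
  show ?thesis
    using length_ge_of_nondegenerate[OF _ card_code minimum_distance_le_weight]
      LCD_iff assms(2) parity_mono[OF assms(3)] by simp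
qed

lemma code_length_ge:
  assumes "linear_code n 6 C" "b \<le> minimum_distance n C"
  shows "63 * b + 31 * (b mod 2) \<le> 32 * n"
proof -
  interpret linear_code_dim_6 n C
    by unfold_locales (rule assms(1))
  show ?thesis
    using length_ge[OF minimum_distance_le_weight, of 1] card_code parity_mono[OF assms(2)] by simp
qed

lemma code_length_ge_of_2_mod_8:
  assumes "linear_code n 6 C" "8 * m + 2 \<le> minimum_distance n C"
  shows "63 * m + 23 \<le> 4 * n"
proof -
  interpret linear_code_dim_6 n C
    by unfold_locales (rule assms(1))
  show ?thesis
    using length_ge_of_min_weight_2_mod_8[OF card_code] assms(2) le_minimum_distance_iff by simp
qed

lemma d_a_ge:
  assumes "linear_code n 6 C" "b \<le> minimum_distance n C"
  shows "b \<le> d_a n 6"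
proof -
  have "finite {minimum_distance n C | C. linear_code n 6 C}"
    by (rule finite_subset[of _ "{..n}"])
      (auto simp: linear_code_dim_6.intro linear_code_dim_6.minimum_distance_le_length)
  then show ?thesis
    unfolding d_a_def using assms by (intro order.trans[OF assms(2)] Max_ge) auto
qed

text \<open>The given code shows that the maximum is taken over a nonempty set; another code may
  attain it.\<close>

lemma d_a_attained:
  assumes "linear_code n 6 C"
  obtains C' where "linear_code n 6 C'" "minimum_distance n C' = d_a n 6"
proof -
  have "finite {minimum_distance n C | C. linear_code n 6 C}"
    by (rule finite_subset[of _ "{..n}"])
      (auto simp: linear_code_dim_6.intro linear_code_dim_6.minimum_distance_le_length)
  then have "d_a n 6 \<in> {minimum_distance n C | C. linear_code n 6 C}"
    unfolding d_a_def using assms by (intro Max_in) auto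
  then show ?thesis
    using that by auto
qed

lemma d_l_ge:
  assumes "linear_code n 6 C" "LCD n C" "b \<le> minimum_distance n C"
  shows "b \<le> d_l n 6"
proof -
  have "finite {minimum_distance n C | C. linear_code n 6 C \<and> LCD n C}"
    by (rule finite_subset[of _ "{..n}"])
      (auto simp: linear_code_dim_6.intro linear_code_dim_6.minimum_distance_le_length)
  then show ?thesis
    unfolding d_l_def using assms by (intro order.trans[OF assms(3)] Max_ge) auto
qed

lemma d_l_attained:
  assumes "linear_code n 6 C" "LCD n C"
  obtains C' where "linear_code n 6 C'" "LCD n C'" "minimum_distance n C' = d_l n 6"
proof -
  have "finite {minimum_distance n C | C. linear_code n 6 C \<and> LCD n C}"
    by (rule finite_subset[of _ "{..n}"])
      (auto simp: linear_code_dim_6.intro linear_code_dim_6.minimum_distance_le_length)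
  then have "d_l n 6 \<in> {minimum_distance n C | C. linear_code n 6 C \<and> LCD n C}"
    unfolding d_l_def using assms by (intro Max_in) auto
  then show ?thesis
    using that by auto
qed

section \<open>Codes given by column multiplicities\<close>

context coordinatized_code
begin

text \<open>The norm formula makes the sum of i^weight over the radical equal to 1. There
  \<open>form\<close> vanishes, so i^weight is multiplicative and translation by \<open>z\<close>
  multiplies the sum by its value at \<open>z\<close>. All values are therefore 1, and the radical
  has one element.\<close>

lemma radical_eq_zero_of_residue_counts:
  assumes "(int (residue_count 0) - int (residue_count 2))\<^sup>2
     + (int (residue_count 1) - int (residue_count 3))\<^sup>2 = int (card C)"
  shows "radical = {0\<^sub>v n}"
proof -
  have "card C > 0"
    using zero_mem finite_code card_gt_0_iff by blast
  have "of_nat (card C) * (\<Sum>z\<in>radical. \<i> ^ weight z) = of_nat (card C) * (1 :: complex)"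
    using residue_count_norm unfolding gauss_sum_norm assms by simp
  then have sum: "(\<Sum>z\<in>radical. \<i> ^ weight z) = (1 :: complex)"
    using \<open>card C > 0\<close> mult_cancel_left[of "of_nat (card C) :: complex"] by simp
  interpret R: binary_code n radical
    using carrier zero_mem_radical radical_closed by unfold_locales (auto simp: radical_def)
  have one: "\<i> ^ weight z = 1" if z: "z \<in> radical" for z
  proof -
    have "(\<Sum>c\<in>radical. \<i> ^ weight c) = (\<Sum>c\<in>radical. \<i> ^ weight (c + z))"
      by (rule R.sum_translation[OF z, symmetric])
    also have "\<dots> = (\<Sum>c\<in>radical. \<i> ^ weight c * \<i> ^ weight z)"
      using z by (intro sum.cong refl) (simp add: i_power_weight_add radical_def)
    also have "\<dots> = (\<Sum>c\<in>radical. \<i> ^ weight c) * \<i> ^ weight z"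
      by (rule sum_distrib_right[symmetric])
    finally show ?thesis
      unfolding sum by simp
  qed
  have "(\<Sum>z\<in>radical. \<i> ^ weight z) = of_nat (card radical)"
    using one by simp
  then have "card radical = 1"
    unfolding sum using of_nat_eq_1_iff by metis
  then show ?thesis
    using zero_mem_radical by (auto simp: card_1_singleton_iff)
qed

end

section \<open>Character sums of column multiplicities\<close>

fun points :: "nat \<Rightarrow> bit vec list" where
  "points 0 = [vNil]"
| "points (Suc k) = map (vCons 0) (points k) @ map (vCons 1) (points k)"

lemma length_points [simp]: "length (points k) = 2 ^ k"
  by (induction k) auto

lemma set_points: "set (points k) = carrier_vec k"
proof (induction k)
  case (Suc k)
  have "v \<in> vCons 0 ` carrier_vec k \<union> vCons 1 ` carrier_vec k" if "v \<in> carrier_vec (Suc k)" for v :: "bit vec"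
  proof -
    have dim: "dim_vec v = Suc k"
      using that by auto
    show ?thesis
    proof (cases v)
      case vNil
      then show ?thesis
        using dim by simp
    next
      case (vCons a w)
      have "dim_vec w = k"
        using dim unfolding vCons dim_vec_vCons by (rule Suc_inject)
      then have "w \<in> carrier_vec k"
        by (rule carrier_vecI)
      moreover have "a = 0 \<or> a = 1"
        by (cases a) simp_all
      ultimately show ?thesis
        using vCons by blast
    qed
  qed
  then show ?case
    using Suc by auto
qed auto

lemma distinct_points: "distinct (points k)"
  by (induction k) (auto simp: distinct_map inj_on_def)

lemma hd_points: "points k = 0\<^sub>v k # tl (points k)"
proof (induction k)
  case (Suc k)
  have "points (Suc k) = map (vCons 0) (0\<^sub>v k # tl (points k)) @ map (vCons 1) (points k)"
    using Suc by simp
  then have "\<exists>ps. points (Suc k) = 0\<^sub>v (Suc k) # ps"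
    unfolding zero_vec_Suc by simp
  then show ?case
    by (metis list.sel(3))
qed auto

text \<open>The fast Walsh-Hadamard transform. Its two halves belong to first coordinate 0 and 1,
  matching the order of \<open>points\<close>; it serves to evaluate the code tables by
  \<open>code_simp\<close>.\<close>

fun walsh :: "nat \<Rightarrow> int list \<Rightarrow> int list" where
  "walsh 0 m = m"
| "walsh (Suc k) m = (let a = walsh k (take (2 ^ k) m); b = walsh k (drop (2 ^ k) m)
     in map2 (+) a b @ map2 (-) a b)"

lemma walsh_eq:
  "length m = 2 ^ k \<Longrightarrow>
    walsh k m = map (\<lambda>u. sum_list (map2 (\<lambda>x c. sign (u \<bullet> x) * c) (points k) m)) (points k)"
proof (induction k arbitrary: m)
  case 0
  then obtain c where "m = [c]"
    by (auto simp: length_Suc_conv)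
  then show ?case
    by simp
next
  case (Suc k)
  define a b where "a = take (2 ^ k) m" and "b = drop (2 ^ k) m"
  have ab: "m = a @ b" "length a = 2 ^ k" "length b = 2 ^ k"
    using Suc.prems by (simp_all add: a_def b_def)
  let ?F = "\<lambda>u m. sum_list (map2 (\<lambda>x c. sign (u \<bullet> x) * c) (points k) m)"
  have "sum_list (map2 (\<lambda>x c. sign (vCons e u \<bullet> x) * c) (points (Suc k)) m)
      = ?F u a + sign e * ?F u b" for e u
    unfolding ab(1)
    by (simp add: ab(2) zip_map1 o_def case_prod_unfold sign_add mult.assoc flip: sum_list_const_mult)
  then show ?case
    using Suc.IH[OF ab(2)] Suc.IH[OF ab(3)]
    by (simp add: Let_def a_def[symmetric] b_def[symmetric] zip_map1 zip_map2 zip_same_conv_map o_def)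
qed


section \<open>Codes generated by a list of columns\<close>

definition word :: "bit vec list \<Rightarrow> bit vec \<Rightarrow> bit vec" where
  "word X u = vec (length X) (\<lambda>i. u \<bullet> X ! i)"

definition generated_code :: "bit vec list \<Rightarrow> bit vec set" where
  "generated_code X = word X ` carrier_vec 6"

lemma hamming_weight_word: "hamming_weight (word X u) = length (filter (\<lambda>x. u \<bullet> x = 1) X)"
  unfolding hamming_weight_def length_filter_conv_card
  by (intro arg_cong[where f = card]) (auto simp: word_def)

lemma word_add:
  assumes "set X \<subseteq> carrier_vec 6" "u \<in> carrier_vec 6" "v \<in> carrier_vec 6"
  shows "word X (u + v) = word X u + word X v"
  using assms nth_mem[of _ X] unfolding word_def
  by (intro eq_vecI) (auto simp: subset_iff intro!: add_scalar_prod_distrib[of _ 6])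

lemma vec_add_self: "u \<in> carrier_vec k \<Longrightarrow> u + u = (0\<^sub>v k :: bit vec)"
  by (intro eq_vecI) auto

lemma word_zero: "word X (0\<^sub>v 6) = 0\<^sub>v (length X)" if "set X \<subseteq> carrier_vec 6"
  using that nth_mem[of _ X] unfolding word_def by (intro eq_vecI) (auto simp: subset_iff)

lemma binary_code_generated:
  assumes X: "set X \<subseteq> carrier_vec 6"
  shows "binary_code (length X) (generated_code X)"
proof
  show "generated_code X \<subseteq> carrier_vec (length X)"
    by (auto simp: generated_code_def word_def)
  show "0\<^sub>v (length X) \<in> generated_code X"
    unfolding generated_code_def word_zero[OF X, symmetric] by (intro imageI) simp
  show "x + y \<in> generated_code X" if "x \<in> generated_code X" "y \<in> generated_code X" for x y
  proof -
    obtain u v where "u \<in> carrier_vec 6" "x = word X u" "v \<in> carrier_vec 6" "y = word X v"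
      using \<open>x \<in> generated_code X\<close> \<open>y \<in> generated_code X\<close> unfolding generated_code_def by blast
    then have "x + y = word X (u + v)" "u + v \<in> carrier_vec 6"
      using word_add[OF X] by simp_all
    then show ?thesis
      unfolding generated_code_def by blast
  qed
qed

lemma hamming_weight_zero [simp]: "hamming_weight (0\<^sub>v n) = 0"
  by (simp add: hamming_weight_def)

lemma inj_on_word:
  assumes X: "set X \<subseteq> carrier_vec 6"
    and pos: "\<forall>u\<in>carrier_vec 6 - {0\<^sub>v 6}. 0 < hamming_weight (word X u)"
  shows "inj_on (word X) (carrier_vec 6)"
proof (rule inj_onI)
  fix u v :: "bit vec" assume u: "u \<in> carrier_vec 6" and v: "v \<in> carrier_vec 6" and eq: "word X u = word X v"
  have "word X (u + v) = word X v + word X v"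
    using word_add[OF X u v] eq by simp
  also have "\<dots> = 0\<^sub>v (length X)"
    by (rule vec_add_self) (simp add: word_def)
  finally have "hamming_weight (word X (u + v)) = 0"
    by simp
  moreover have "u + v \<in> carrier_vec 6"
    using u v by simp
  ultimately have 0: "u + v = 0\<^sub>v 6"
    using pos by (metis Diff_iff less_irrefl singletonD)
  have "u = (u + v) + v"
    using u v vec_add_self[OF v] by (simp add: assoc_add_vec[of _ 6])
  then show "u = v"
    using 0 v by simp
qed

lemma linear_code_generated:
  assumes X: "set X \<subseteq> carrier_vec 6 - {0\<^sub>v 6}"
    and pos: "\<forall>u\<in>carrier_vec 6 - {0\<^sub>v 6}. 0 < hamming_weight (word X u)"
  shows "linear_code (length X) 6 (generated_code X)"
proof -
  have X': "set X \<subseteq> carrier_vec 6"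
    using X by blast
  have "card (carrier_vec 6 :: bit vec set) = 64"
    unfolding set_points[symmetric] using distinct_card[OF distinct_points[of 6]] by simp
  then have "card (generated_code X) = 2 ^ 6"
    unfolding generated_code_def using card_image[OF inj_on_word[OF X' pos]] by simp
  moreover have "no_zero_coordinate (length X) (generated_code X)"
    unfolding no_zero_coordinate_def
  proof (intro allI impI)
    fix i assume i: "i < length X"
    then have x: "X ! i \<in> carrier_vec 6" "X ! i \<noteq> 0\<^sub>v 6"
      using X nth_mem by blast+
    then obtain j where j: "j < 6" "X ! i $ j \<noteq> 0"
      by (metis carrier_vecD eq_vecI index_zero_vec)
    have "word X (unit_vec 6 j) $ i = X ! i $ j"
      using i j x by (simp add: word_def)
    then show "\<exists>c\<in>generated_code X. c $ i \<noteq> 0"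
      using j unfolding generated_code_def by (metis imageI unit_vec_carrier)
  qed
  ultimately show ?thesis
    using binary_code_generated[OF X'] by (simp add: linear_code_iff)
qed


text \<open>Only nonzero points become columns, so no coordinate vanishes. The common summand
  \<open>s\<close> adds \<open>s\<close> copies of the simplex code.\<close>

definition columns :: "nat \<Rightarrow> nat list \<Rightarrow> bit vec list" where
  "columns s m = concat (map2 (\<lambda>x c. replicate (c + s) x) (tl (points 6)) m)"

text \<open>A weight is half the difference between the length and the Walsh coefficient; the
  prepended 0 is the multiplicity of the zero column.\<close>

definition weights :: "nat list \<Rightarrow> int list" where
  "weights m = map (\<lambda>y. (int (sum_list m) - y) div 2) (walsh 6 (0 # map int m))"

lemma nonzero_points: "set (tl (points k)) = carrier_vec k - {0\<^sub>v k}"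
proof -
  have "distinct (0\<^sub>v k # tl (points k))" "set (0\<^sub>v k # tl (points k)) = carrier_vec k"
    using hd_points[of k] distinct_points[of k] set_points[of k] by metis+
  then show ?thesis
    by auto
qed

lemma set_columns: "set (columns s m) \<subseteq> carrier_vec 6 - {0\<^sub>v 6}"
  unfolding columns_def nonzero_points[symmetric] by (auto dest: set_zip_leftD)

lemma sum_list_map2_add_const:
  "length xs = length m \<Longrightarrow>
    sum_list (map2 (\<lambda>x c. f x * int (c + s)) xs m)
      = sum_list (map2 (\<lambda>x c. f x * int c) xs m) + int s * sum_list (map f xs)"
  by (induction xs m rule: list_induct2) (auto simp: algebra_simps)

lemma length_filter_columns:
  "length xs = length m \<Longrightarrow>
    2 * int (length (filter (\<lambda>x. u \<bullet> x = 1) (concat (map2 (\<lambda>x c. replicate (c + s) x) xs m))))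
      = sum_list (map2 (\<lambda>x c. (1 - sign (u \<bullet> x)) * int (c + s)) xs m)"
  by (induction xs m rule: list_induct2) (auto simp: sign_def algebra_simps)

lemma length_columns:
  assumes "length m = 63"
  shows "length (columns s m) = sum_list m + 63 * s"
proof -
  have "length (concat (map2 (\<lambda>x c. replicate (c + s) x) xs m)) = sum_list m + length m * s"
    if "length xs = length m" for xs :: "bit vec list"
    using that by (induction xs m rule: list_induct2) auto
  from this[of "tl (points 6)"] show ?thesis
    using assms by (simp add: columns_def)
qed

lemma walsh_simplex: "walsh 6 (0 # replicate 63 1) = 63 # replicate 63 (-1)"
  by code_simp

text \<open>Character sums are additive in the multiplicities, and those of the simplex code are -1
  at every nonzero \<open>u\<close>: each copy adds (63 + 1) / 2 = 32 there, and nothing at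
  zero.\<close>

lemma weights_eq:
  assumes m: "length m = 63"
  shows "map (\<lambda>u. int (hamming_weight (word (columns s m) u))) (points 6)
    = hd (weights m) # map (\<lambda>w. w + 32 * int s) (tl (weights m))"
proof -
  let ?F = "\<lambda>u. sum_list (map2 (\<lambda>x c. sign (u \<bullet> x) * int c) (tl (points 6)) m)"
  let ?E = "\<lambda>u. sum_list (map (\<lambda>x. sign (u \<bullet> x)) (tl (points 6)))"
  have len: "length (tl (points 6)) = length m"
    using m by simp
  have split: "sum_list (map2 f (points 6) (c # cs)) = f (0\<^sub>v 6) c + sum_list (map2 f (tl (points 6)) cs)"
    for f :: "bit vec \<Rightarrow> int \<Rightarrow> int" and c cs
    by (subst hd_points) simp
  have W: "walsh 6 (0 # map int m) = map ?F (points 6)"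
    using m unfolding walsh_eq[of "0 # map int m" 6, simplified, OF m] split
    by (simp add: zip_map2 case_prod_unfold o_def)
  have "walsh 6 (0 # replicate 63 1) = map ?E (points 6)"
    unfolding walsh_eq[of "0 # replicate 63 1" 6, simplified] split
    by (simp add: zip_replicate2 o_def)
  then have E: "map ?E (points 6) = 63 # replicate 63 (-1)"
    by (simp only: walsh_simplex)
  have E0: "?E (0\<^sub>v 6) = 63" and E1: "map ?E (tl (points 6)) = replicate 63 (-1)"
    using E hd_points[of 6] by (metis list.inject list.simps(9))+
  have E1: "?E u = -1" if "u \<in> set (tl (points 6))" for u
  proof -
    have "?E u \<in> set (replicate 63 (-1))"
      using that unfolding E1[symmetric] by simp
    then show ?thesis
      by simp
  qed
  have *: "2 * int (hamming_weight (word (columns s m) u))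
      = int (sum_list m) - ?F u + int s * (63 - ?E u)" for u
  proof -
    have "2 * int (hamming_weight (word (columns s m) u))
      = sum_list (map2 (\<lambda>x c. (1 - sign (u \<bullet> x)) * int (c + s)) (tl (points 6)) m)"
      unfolding hamming_weight_word columns_def by (rule length_filter_columns[OF len])
    also have "\<dots> = sum_list (map2 (\<lambda>x c. (1 - sign (u \<bullet> x)) * int c) (tl (points 6)) m)
        + int s * sum_list (map (\<lambda>x. 1 - sign (u \<bullet> x)) (tl (points 6)))"
      by (rule sum_list_map2_add_const[OF len])
    also have "sum_list (map (\<lambda>x. 1 - sign (u \<bullet> x)) (tl (points 6))) = 63 - ?E u"
      by (simp add: sum_list_subtractf sum_list_triv)
    also have "sum_list (map2 (\<lambda>x c. (1 - sign (u \<bullet> x)) * int c) xs m)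
        = int (sum_list m) - sum_list (map2 (\<lambda>x c. sign (u \<bullet> x) * int c) xs m)"
      if "length xs = length m" for xs
      using that by (induction xs m rule: list_induct2) (auto simp: algebra_simps)
    from this[OF len] have "sum_list (map2 (\<lambda>x c. (1 - sign (u \<bullet> x)) * int c) (tl (points 6)) m)
        = int (sum_list m) - ?F u" .
    finally show ?thesis .
  qed
  have weights: "weights m = map (\<lambda>u. (int (sum_list m) - ?F u) div 2) (points 6)"
    unfolding weights_def W by simp
  have "int (hamming_weight (word (columns s m) (0\<^sub>v 6))) = (int (sum_list m) - ?F (0\<^sub>v 6)) div 2"
    using *[of "0\<^sub>v 6"] unfolding E0 by simp
  moreover have "int (hamming_weight (word (columns s m) u)) = (int (sum_list m) - ?F u) div 2 + 32 * int s"
    if "u \<in> set (tl (points 6))" for u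
    using *[of u] unfolding E1[OF that] by simp
  ultimately show ?thesis
    unfolding weights by (subst (1 2 3) hd_points) simp
qed

definition min_weight_ge :: "nat list \<Rightarrow> nat \<Rightarrow> bool" where
  "min_weight_ge m d \<longleftrightarrow> length m = 63 \<and> list_all (\<lambda>w. int d \<le> w) (tl (weights m))"

text \<open>The squared norm of the Gauss sum, with the zero word included. It is the same for every
  \<open>s\<close>, since 32 is divisible by 4.\<close>

definition gauss_norm_64 :: "nat list \<Rightarrow> bool" where
  "gauss_norm_64 m \<longleftrightarrow> (let ws = map (\<lambda>w. w mod 4) (weights m);
      c = (\<lambda>p. int (length (filter (\<lambda>w. w = p) ws)))
    in (c 0 - c 2)\<^sup>2 + (c 1 - c 3)\<^sup>2 = 64)"

context
  fixes m :: "nat list" and d s :: nat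
  assumes m: "min_weight_ge m d" and d: "0 < d"
begin

lemma length_table: "length m = 63"
  using m by (simp add: min_weight_ge_def)

lemma columns_carrier: "set (columns s m) \<subseteq> carrier_vec 6"
  using set_columns by blast

lemma hamming_weight_ge:
  assumes "u \<in> carrier_vec 6 - {0\<^sub>v 6}"
  shows "d + 32 * s \<le> hamming_weight (word (columns s m) u)"
proof -
  let ?f = "\<lambda>u. int (hamming_weight (word (columns s m) u))"
  have "map ?f (tl (points 6)) = map (\<lambda>w. w + 32 * int s) (tl (weights m))"
    using arg_cong[OF weights_eq[OF length_table, of s], of tl] by (simp add: map_tl)
  then have "?f ` set (tl (points 6)) = (\<lambda>w. w + 32 * int s) ` set (tl (weights m))"
    by (metis list.set_map)
  moreover have "u \<in> set (tl (points 6))"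
    using assms nonzero_points by simp
  ultimately obtain w where "w \<in> set (tl (weights m))" "?f u = w + 32 * int s"
    by blast
  moreover have "int d \<le> w"
    using m \<open>w \<in> set (tl (weights m))\<close> by (simp add: min_weight_ge_def list_all_iff)
  ultimately show ?thesis
    by linarith
qed

lemma linear_code_columns:
  "linear_code (sum_list m + 63 * s) 6 (generated_code (columns s m))"
proof -
  have "\<forall>u\<in>carrier_vec 6 - {0\<^sub>v 6}. 0 < hamming_weight (word (columns s m) u)"
    using hamming_weight_ge d by fastforce
  then show ?thesis
    using linear_code_generated[OF set_columns, of s m] length_columns[OF length_table]
    by simp
qed

interpretation X: linear_code_dim_6 "sum_list m + 63 * s" "generated_code (columns s m)"
  by unfold_locales (rule linear_code_columns)

lemma minimum_distance_columns:
  "d + 32 * s \<le> minimum_distance (sum_list m + 63 * s) (generated_code (columns s m))"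
  unfolding X.le_minimum_distance_iff
proof
  fix c assume c: "c \<in> generated_code (columns s m) - {0\<^sub>v (sum_list m + 63 * s)}"
  then obtain u where u: "u \<in> carrier_vec 6" "c = word (columns s m) u"
    by (auto simp: generated_code_def)
  have "u \<noteq> 0\<^sub>v 6"
    using c word_zero[OF columns_carrier] length_columns[OF length_table]
    by (auto simp: u)
  then show "d + 32 * s \<le> X.weight c"
    using hamming_weight_ge u c X.weight_eq_hamming_weight by simp
qed

text \<open>Nonzero \<open>u\<close> give words of positive weight, so \<open>word\<close> is
  injective and words may be counted by points.\<close>

lemma residue_count_columns:
  assumes "p < 4"
  shows "X.residue_count p = length (filter (\<lambda>w. w mod 4 = int p) (weights m))"
proof -
  let ?h = "\<lambda>u. hamming_weight (word (columns s m) u)"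
  have pos: "\<forall>u\<in>carrier_vec 6 - {0\<^sub>v 6}. 0 < ?h u"
    using hamming_weight_ge d by fastforce
  have inj: "inj_on (word (columns s m)) (carrier_vec 6)"
    by (rule inj_on_word[OF columns_carrier pos])
  have "{c \<in> generated_code (columns s m). X.weight c mod 4 = p}
      = word (columns s m) ` {u \<in> carrier_vec 6. ?h u mod 4 = p}"
    using X.weight_eq_hamming_weight by (auto simp: generated_code_def)
  then have "X.residue_count p = card {u \<in> carrier_vec 6. ?h u mod 4 = p}"
    unfolding X.residue_count_def using inj
    by (simp add: card_image inj_on_subset)
  also have "{u \<in> carrier_vec 6. ?h u mod 4 = p} = {u. int (?h u) mod 4 = int p} \<inter> set (points 6)"
  proof -
    have "int (?h u) mod 4 = int p \<longleftrightarrow> ?h u mod 4 = p" for u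
      using zmod_int[of "?h u" 4] of_nat_eq_iff[of "?h u mod 4" p, where 'a = int] by simp
    then show ?thesis
      unfolding set_points by auto
  qed
  also have "card \<dots> = length (filter (\<lambda>u. int (?h u) mod 4 = int p) (points 6))"
    by (rule distinct_length_filter[OF distinct_points, symmetric])
  also have "\<dots> = length (filter (\<lambda>w. w mod 4 = int p) (map (\<lambda>u. int (?h u)) (points 6)))"
    by (simp add: filter_map o_def)
  also have "map (\<lambda>u. int (?h u)) (points 6) = hd (weights m) # map (\<lambda>w. w + 32 * int s) (tl (weights m))"
    by (rule weights_eq[OF length_table])
  also have "length (filter (\<lambda>w. w mod 4 = int p) (hd (weights m) # map (\<lambda>w. w + 32 * int s) (tl (weights m))))
      = length (filter (\<lambda>w. w mod 4 = int p) (hd (weights m) # tl (weights m)))"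
  proof -
    have "(w + 32 * int s) mod 4 = w mod 4" for w
      by presburger
    then show ?thesis
      by (simp add: filter_map o_def)
  qed
  moreover have "length (walsh 6 (0 # map int m)) = 64"
    using length_table by (subst walsh_eq) simp_all
  then have "weights m \<noteq> []"
    by (auto simp: weights_def)
  then have "hd (weights m) # tl (weights m) = weights m"
    by (rule list.collapse)
  ultimately show ?thesis
    by simp
qed

lemma LCD_columns:
  assumes "gauss_norm_64 m"
  shows "LCD (sum_list m + 63 * s) (generated_code (columns s m))"
  unfolding X.LCD_iff
proof (rule X.radical_eq_zero_of_residue_counts)
  show "(int (X.residue_count 0) - int (X.residue_count 2))\<^sup>2
     + (int (X.residue_count 1) - int (X.residue_count 3))\<^sup>2 = int (card (generated_code (columns s m)))"
    using assms unfolding X.card_code gauss_norm_64_def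
    by (simp add: residue_count_columns filter_map o_def Let_def)
qed

end

section \<open>Code tables\<close>

text \<open>The entries with index \<open>i\<close> belong to length \<open>51 + i\<close>.  The multiplicities were found by a
  randomized computer search and are listed in the order of \<^term>\<open>tl (points 6)\<close>.\<close>

definition lcd_distances :: "nat list" where
  "lcd_distances = [24, 24, 25, 26, 26, 26, 27, 28, 28, 28, 29, 30, 30, 30, 31, 32, 32, 32, 33, 34, 34, 34,
     35, 36, 36, 36, 37, 38, 38, 38, 39, 40, 40, 40, 41, 42, 42, 42, 43, 44, 44, 44, 45, 46,
     46, 46, 47, 48, 48, 48, 49, 50, 50, 51, 52, 52, 52, 52, 53, 54, 54, 55, 56]"

definition lcd_multiplicities :: "nat list list" where
  "lcd_multiplicities =
   [[1,1,1,1,1,1,0,1,0,0,1,0,1,1,1,1,1,1,1,1,1,2,0,2,1,1,0,1,0,1,2,0,0,1,0,0,1,1,0,0,1,1,1,1,0,1,0,1,1,1,1,1,1,1,1,1,2,0,1,1,1,1,1],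
    [1,1,1,1,1,1,1,1,0,2,0,1,0,1,1,1,1,1,0,1,1,1,0,1,1,1,1,0,1,1,1,0,1,1,1,0,0,0,1,2,1,1,0,1,0,1,1,1,1,0,2,2,1,0,0,1,0,0,1,1,2,2,1],
    [1,1,1,1,1,1,1,1,0,1,1,1,1,1,1,1,0,1,1,0,1,1,1,0,1,1,1,1,1,1,1,1,0,1,2,0,1,1,1,1,1,1,0,1,0,1,1,0,1,1,1,1,0,1,1,1,0,1,1,1,1,1,1],
    [1,2,0,1,0,1,1,1,1,1,1,1,1,1,1,1,0,1,1,0,1,1,1,1,1,1,1,1,1,1,1,0,1,1,0,1,0,0,1,1,1,1,1,2,1,0,1,1,0,0,1,1,1,1,1,1,1,1,1,1,1,1,1],
    [0,1,1,2,2,0,1,0,1,0,0,1,1,2,1,1,1,1,1,1,2,1,1,1,1,1,0,1,1,1,1,1,1,0,0,2,0,2,2,0,0,0,1,2,1,1,1,1,0,0,0,1,1,1,1,1,0,1,1,1,1,1,1],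
    [1,2,1,1,1,0,2,0,1,1,0,2,1,1,1,2,1,0,1,0,1,1,2,2,1,0,1,0,1,1,1,0,1,1,1,1,1,0,1,1,1,2,1,2,1,1,0,1,1,1,1,1,0,0,1,3,1,0,0,0,0,1,0],
    [1,1,1,1,1,1,1,0,1,1,1,1,1,1,1,1,1,1,1,1,1,0,1,1,1,1,1,0,1,0,1,1,1,1,0,1,1,1,1,2,1,1,1,1,1,1,0,1,1,1,0,1,1,1,1,1,1,1,1,1,1,1,1],
    [0,1,0,1,1,1,1,1,1,1,1,1,1,1,1,1,1,1,1,1,1,1,1,1,1,1,2,1,1,1,1,1,1,0,0,1,0,0,1,1,1,1,1,1,1,0,1,1,1,1,1,1,2,1,1,1,1,1,1,1,1,1,1],
    [1,1,1,1,1,1,1,1,2,1,0,2,1,1,0,1,1,1,1,1,1,0,1,1,1,1,1,1,1,2,1,0,1,1,1,1,1,0,1,1,1,2,1,1,1,0,1,1,1,1,2,1,0,0,1,1,1,0,1,2,0,1,1],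
    [1,2,1,0,0,1,1,2,3,0,1,1,3,1,1,2,1,0,1,1,2,1,0,0,0,2,1,0,0,1,2,0,0,2,0,0,1,0,0,2,1,1,1,0,2,3,1,1,0,1,1,1,0,2,1,1,1,1,0,2,0,1,1],
    [1,1,1,1,1,1,2,1,0,1,1,1,1,2,1,1,1,1,1,1,1,1,1,1,1,1,1,1,0,1,1,1,1,1,1,1,0,1,1,1,1,1,1,1,1,1,1,1,1,1,1,0,2,1,1,0,1,1,1,1,1,1,1],
    [2,1,1,1,1,1,1,1,1,1,1,1,1,1,1,0,2,1,1,1,1,1,1,1,1,1,1,1,0,1,2,1,1,1,2,2,0,1,1,0,1,1,1,1,1,1,1,1,1,1,1,1,0,1,1,0,2,1,1,0,1,1,1],
    [1,0,1,2,2,1,2,1,0,1,1,1,1,1,1,2,1,2,1,1,0,1,0,1,2,1,0,1,0,1,1,0,1,0,1,1,2,1,3,1,0,1,1,1,2,2,0,2,1,1,1,0,0,2,0,1,1,1,1,1,1,1,1],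
    [1,2,0,0,1,2,0,1,1,1,3,2,0,1,1,0,1,2,0,0,1,2,1,1,1,2,2,0,1,1,1,0,1,0,2,2,0,0,1,0,1,1,2,2,1,1,0,1,0,1,1,1,1,1,1,2,1,1,2,1,1,1,2],
    [0,1,1,1,1,1,1,1,1,1,1,1,1,1,1,1,1,2,1,1,1,1,1,1,1,1,1,1,1,1,1,2,1,1,1,1,1,1,1,1,1,1,1,1,1,1,1,0,1,0,1,1,1,1,1,1,1,2,2,2,1,1,1],
    [2,2,0,2,1,0,2,1,1,1,1,1,1,1,2,1,1,1,1,1,1,1,1,1,1,1,1,1,1,1,1,1,1,1,1,1,1,0,1,1,2,1,1,1,1,1,1,0,2,1,0,1,1,1,2,1,1,1,1,1,1,1,1],
    [1,2,0,2,1,1,2,1,1,1,0,1,1,1,2,1,2,1,0,1,0,0,1,1,1,1,1,1,1,1,1,1,2,1,0,1,1,1,2,0,1,2,1,2,0,1,2,1,1,2,2,1,1,0,1,1,3,2,1,1,0,0,1],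
    [1,0,1,2,1,2,1,0,1,1,1,1,1,2,1,1,1,2,0,1,2,1,2,0,1,1,1,2,1,1,1,1,2,1,1,0,1,1,1,1,1,1,2,1,1,2,1,0,1,2,1,1,1,2,0,1,1,1,1,0,1,2,1],
    [1,1,1,1,1,1,1,2,1,1,1,1,1,1,1,1,1,1,1,1,0,1,1,1,1,1,2,1,1,1,1,1,1,1,1,1,1,1,1,2,1,1,1,1,1,1,1,1,1,2,1,1,1,2,1,1,1,1,1,2,2,1,1],
    [1,1,1,1,1,1,1,1,1,1,1,2,1,2,1,0,1,1,1,1,1,1,1,1,2,1,1,1,1,2,1,1,1,1,2,1,1,1,2,1,1,1,1,1,1,2,1,1,1,1,2,1,1,2,1,1,1,0,1,1,1,1,1],
    [0,0,1,2,1,1,1,1,1,0,0,0,2,1,2,0,1,1,1,1,1,1,1,1,1,1,1,1,2,1,1,2,1,1,0,1,2,1,2,1,2,1,2,2,1,2,1,2,2,1,0,1,1,1,2,1,1,2,2,1,1,1,1],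
    [1,2,1,1,1,2,1,1,1,1,1,1,1,1,1,1,1,1,1,1,1,1,1,1,2,2,1,1,1,1,1,1,1,1,2,1,1,1,1,1,2,2,0,1,2,1,1,1,1,1,1,1,1,2,1,2,1,1,1,1,1,1,1],
    [2,1,1,2,1,1,2,0,1,1,1,1,1,1,1,1,1,1,1,1,1,1,1,0,1,1,1,2,1,1,1,1,1,2,0,2,1,1,2,2,1,2,1,1,1,1,1,2,1,2,1,1,1,1,1,1,1,2,1,1,1,1,2],
    [0,2,1,1,1,2,2,1,1,1,1,1,1,2,1,1,1,1,1,1,1,2,2,1,1,2,2,1,0,1,2,2,2,1,1,2,1,0,1,2,1,1,2,1,1,0,0,1,1,1,1,1,2,1,1,2,2,1,0,1,1,1,1],
    [1,1,0,1,1,1,0,1,1,1,2,1,0,0,1,1,1,1,2,1,1,2,1,1,1,1,2,2,1,2,1,0,2,1,1,1,1,2,1,1,1,1,2,1,0,1,1,1,2,2,2,1,1,2,0,2,1,1,2,2,1,3,2],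
    [1,2,0,2,0,1,1,1,2,3,1,1,1,1,3,2,2,1,1,1,1,2,2,1,1,1,1,1,2,1,0,2,1,2,3,0,1,2,1,0,0,1,1,0,1,2,1,1,2,2,0,1,1,1,1,1,2,2,0,1,1,1,1],
    [2,2,1,1,1,1,1,1,2,1,1,1,1,1,1,1,1,0,2,1,2,1,1,1,1,1,2,0,1,1,1,1,2,2,0,2,1,1,1,1,2,2,1,2,1,1,1,2,0,1,2,1,2,2,1,2,1,1,1,2,1,1,1],
    [0,1,2,1,1,1,1,1,2,1,2,1,1,1,1,1,1,1,1,1,1,2,2,1,1,2,2,1,2,1,1,1,1,2,2,2,1,1,1,1,1,1,1,1,0,2,1,2,1,2,1,1,1,2,2,1,0,2,2,1,1,1,1],
    [1,2,1,1,2,2,1,1,1,0,1,2,2,1,1,1,1,1,1,0,2,1,1,1,1,1,1,1,1,1,3,1,2,3,1,0,1,2,1,2,1,1,1,1,1,1,1,1,2,2,1,1,2,2,1,1,1,2,2,2,0,1,1],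
    [2,1,2,3,0,2,1,1,1,2,1,2,1,2,2,1,1,1,1,1,2,0,1,3,1,2,0,2,1,0,2,1,1,0,1,2,1,2,0,0,3,0,1,2,1,3,1,2,0,2,1,1,1,0,2,1,1,2,2,0,1,1,2],
    [1,2,2,0,1,2,2,2,1,1,2,1,1,1,2,1,1,1,1,1,2,1,1,1,1,1,1,1,1,1,2,2,1,1,1,1,2,1,1,2,2,1,1,2,1,1,1,2,2,1,1,2,1,1,1,1,1,2,1,1,1,2,1],
    [1,2,2,1,0,2,1,2,1,1,1,1,2,1,1,1,1,2,1,1,1,1,2,2,2,0,2,2,1,1,1,1,1,1,1,1,2,1,1,1,1,2,1,1,1,1,2,2,2,1,1,2,2,1,1,1,1,2,2,1,1,1,2],
    [1,1,1,2,2,2,1,1,1,1,2,1,3,1,1,2,1,1,1,2,2,2,2,1,1,1,2,2,0,1,1,2,1,2,1,1,1,2,1,2,1,1,0,2,1,1,1,2,2,2,1,0,1,0,1,2,1,1,2,1,1,1,2],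
    [1,0,2,2,1,2,2,1,2,2,2,2,1,2,1,2,0,3,1,1,1,2,2,1,1,2,1,0,1,1,2,1,2,1,1,0,1,0,1,1,2,1,1,2,2,3,2,2,1,2,1,1,2,1,1,1,1,2,1,1,1,0,1],
    [1,2,1,2,1,1,2,1,1,2,1,2,1,1,2,2,1,1,1,1,2,2,1,2,1,0,2,1,1,3,2,1,1,1,1,2,1,1,2,1,2,2,1,1,1,1,1,2,0,1,2,1,2,2,1,1,1,1,1,1,2,2,1],
    [2,2,1,1,1,2,1,1,2,3,1,1,2,1,1,2,1,2,2,2,1,1,2,1,1,1,1,2,1,0,2,1,1,2,1,1,1,1,1,1,2,1,1,2,2,1,1,1,1,2,2,1,2,1,2,1,1,1,2,2,1,1,1],
    [2,0,2,2,1,1,2,1,1,0,1,1,2,2,1,2,1,1,1,1,2,2,2,1,2,1,2,1,2,1,2,1,2,1,2,2,1,2,1,1,2,2,2,2,2,1,2,1,1,1,1,1,2,1,1,1,2,0,1,1,1,2,1],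
    [2,1,1,2,1,1,1,1,1,1,2,2,2,3,0,2,1,1,2,2,3,1,1,0,1,1,0,1,2,1,2,2,2,1,2,2,2,2,1,2,2,1,1,2,0,2,1,1,1,2,1,1,0,1,1,2,2,2,1,1,1,2,2],
    [1,1,1,2,1,2,2,2,2,1,2,2,1,1,1,1,1,2,1,1,1,1,1,2,1,1,2,1,2,2,2,1,1,0,2,2,2,2,2,1,2,1,1,1,1,1,1,2,1,2,2,2,2,1,2,1,2,2,1,1,1,1,1],
    [1,1,1,2,2,3,2,1,1,1,2,2,1,2,2,1,1,1,1,2,2,2,2,1,1,1,1,2,2,1,1,1,2,2,1,1,1,2,1,1,1,1,2,1,1,2,2,2,1,1,1,1,2,1,2,1,1,1,1,1,2,2,2],
    [1,2,0,0,2,3,0,1,2,2,1,1,2,2,1,1,1,2,3,2,1,2,2,2,1,1,2,2,0,1,2,2,3,2,2,2,2,1,1,2,1,0,1,2,1,1,2,1,2,1,1,2,2,1,0,2,1,1,1,2,1,1,2],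
    [1,1,1,2,1,2,1,2,2,1,1,1,2,2,2,2,1,2,2,2,3,2,1,2,1,2,1,1,1,1,2,3,2,2,1,1,2,2,1,0,1,2,1,1,1,2,2,2,2,2,1,0,0,1,2,1,1,1,2,1,2,2,0],
    [1,1,1,1,2,2,2,2,2,2,2,2,2,2,1,1,1,2,2,1,1,1,1,2,1,2,2,2,1,1,1,1,1,1,2,1,2,1,2,2,2,2,2,1,1,1,1,1,1,1,1,1,2,2,1,1,1,2,1,2,2,2,2],
    [2,1,1,2,1,2,1,1,1,2,1,2,1,1,2,2,2,2,2,1,2,2,1,3,1,2,1,1,2,1,2,1,2,1,1,2,1,2,1,2,1,2,1,1,1,0,2,1,2,1,2,1,2,3,1,2,0,1,2,1,2,2,2],
    [1,1,1,1,2,1,2,2,2,2,1,3,2,2,2,2,2,1,1,1,1,2,1,1,1,2,2,1,2,2,2,3,2,1,2,2,1,2,2,1,1,2,2,1,0,1,1,1,1,2,2,1,1,1,1,2,1,1,1,2,1,2,2],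
    [1,2,2,2,2,1,1,3,1,1,2,2,2,1,1,0,1,2,2,2,2,1,0,1,0,2,2,2,2,1,2,2,1,2,2,1,2,1,2,2,2,1,0,2,1,2,1,2,1,2,1,2,2,2,2,3,2,1,2,1,1,1,1],
    [1,1,2,1,1,1,1,2,2,3,2,2,1,2,2,2,2,2,2,2,2,2,2,1,1,1,1,1,1,1,1,3,2,2,2,2,2,2,1,1,1,1,1,1,2,1,1,1,0,2,1,1,1,1,2,2,2,2,2,2,1,2,2],
    [1,2,2,1,2,2,1,2,2,2,2,2,2,1,1,1,2,2,1,1,2,2,1,1,1,2,1,2,2,1,1,1,2,2,1,1,2,1,1,1,1,3,2,1,2,2,2,1,2,2,1,2,3,2,1,1,2,2,2,1,1,1,1],
    [1,3,2,1,2,2,1,3,1,0,1,2,1,1,2,2,1,1,3,2,1,1,2,2,2,2,1,2,2,2,0,3,1,1,2,1,1,1,2,1,2,2,1,1,2,2,1,1,2,2,1,2,3,2,1,2,1,1,1,2,1,1,3],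
    [2,1,3,3,1,1,1,1,1,2,1,2,2,1,0,3,1,2,2,0,3,1,1,1,1,3,2,2,2,2,2,1,2,1,3,2,2,1,0,1,0,3,2,2,2,1,1,0,1,2,2,2,2,1,3,2,2,1,1,3,1,2,1],
    [2,2,1,1,2,2,1,1,2,2,1,1,2,2,1,1,2,2,1,1,3,2,1,1,3,2,1,1,2,2,1,2,1,2,3,1,1,2,2,2,2,1,2,2,1,2,2,2,1,1,2,2,1,1,1,2,1,1,1,2,2,2,2],
    [1,2,1,2,2,2,1,1,2,1,1,1,1,2,1,1,0,1,1,2,1,1,3,2,1,1,1,1,2,1,2,1,2,2,2,2,1,2,2,2,2,1,2,2,2,2,2,2,2,2,2,1,1,2,3,2,1,2,2,2,3,2,2],
    [1,1,2,1,0,2,2,2,2,1,0,2,2,0,0,2,2,1,1,2,2,1,1,1,1,1,3,2,1,3,1,1,2,3,3,2,1,3,2,2,2,2,1,3,3,1,2,3,2,1,1,2,3,0,1,1,1,2,3,2,0,3,2],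
    [1,2,1,1,2,2,2,1,2,2,1,2,2,2,2,2,2,2,2,2,1,2,2,2,2,2,1,2,1,1,1,2,1,1,2,1,1,1,2,2,2,1,2,2,2,1,2,2,1,2,2,2,2,2,2,2,1,1,1,2,2,2,1],
    [2,2,1,1,2,2,2,1,2,2,1,2,2,2,2,2,2,2,2,2,1,2,2,2,2,2,1,2,1,1,1,2,1,1,2,1,1,1,2,2,2,1,2,2,2,1,2,2,1,2,2,2,2,2,2,2,1,1,1,2,2,2,1],
    [2,2,1,1,3,1,1,2,2,2,2,1,2,2,1,2,1,2,2,3,1,2,2,3,2,1,2,1,1,2,2,2,2,1,2,2,2,2,2,1,3,2,2,1,2,1,2,1,1,1,1,2,2,2,1,2,1,2,2,2,1,1,1],
    [3,2,2,1,1,2,2,2,2,1,1,3,1,1,2,2,1,1,2,1,3,2,2,2,1,1,2,2,2,3,0,2,2,2,1,2,2,1,1,1,1,2,2,1,1,1,3,2,1,2,2,1,2,2,1,2,2,2,2,2,2,2,2],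
    [3,1,1,2,1,3,0,1,2,1,2,2,2,2,2,2,1,2,1,1,1,1,1,3,1,2,2,1,1,1,2,3,0,2,1,1,3,2,2,2,2,2,1,2,2,2,2,1,3,1,4,3,1,1,1,1,3,2,3,2,1,2,2],
    [1,2,2,2,1,1,2,2,2,1,1,1,2,1,2,2,2,2,1,2,2,1,2,2,2,2,2,2,2,2,2,2,2,1,2,1,1,2,1,2,1,2,2,1,2,2,2,2,2,1,1,1,2,2,2,2,2,2,3,2,3,2,1],
    [1,1,2,2,2,2,2,2,2,1,2,2,1,3,2,2,2,1,2,2,2,2,2,1,1,2,2,2,2,2,2,2,1,1,1,2,2,1,1,2,2,2,1,2,1,2,2,2,2,2,2,1,2,2,3,2,1,2,1,2,2,2,1],
    [1,3,2,1,1,3,2,1,2,2,2,2,2,2,1,2,2,1,1,2,2,1,1,2,2,1,2,2,1,1,1,2,3,1,1,2,1,2,1,2,3,2,2,2,2,3,1,1,1,2,3,1,1,3,3,2,1,1,2,2,2,3,2],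
    [1,2,2,1,1,2,2,2,2,2,2,2,1,2,2,2,2,2,2,2,2,2,2,1,2,2,2,1,2,2,2,2,2,2,2,2,1,2,2,1,2,2,2,2,2,2,2,1,2,2,2,1,2,2,2,2,1,1,2,2,1,2,1],
    [2,2,2,1,1,2,2,2,2,2,2,2,1,2,2,2,2,2,2,2,2,2,2,1,2,2,2,1,2,2,2,2,2,2,2,2,1,2,2,1,2,2,2,2,2,2,2,1,2,2,2,1,2,2,2,2,1,1,2,2,1,2,1]]"

text \<open>Length, minimum distance and multiplicities: two copies of the simplex code with the nonzero
  points of some subspaces removed (as in the Belov codes), up to one extra or one deleted column.\<close>

definition optimal_codes :: "(nat \<times> nat \<times> nat list) list" where
  "optimal_codes =
   [(84, 41, [1,1,2,2,0,2,1,2,1,2,1,1,2,1,2,2,1,2,1,1,2,0,2,1,1,1,2,1,1,2,1,1,2,1,2,2,1,2,0,2,1,1,1,1,2,1,1,2,0,2,0,1,2,0,2,1,2,1,2,2,1,2,1]),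
    (85, 42, [2,1,2,2,0,2,1,2,1,2,1,1,2,1,2,2,1,2,1,1,2,0,2,1,1,1,2,1,1,2,1,1,2,1,2,2,1,2,0,2,1,1,1,1,2,1,1,2,0,2,0,1,2,0,2,1,2,1,2,2,1,2,1]),
    (88, 44, [1,1,1,2,2,2,2,2,2,2,2,1,1,1,0,1,1,1,1,1,2,2,2,2,2,2,1,1,1,1,1,0,1,1,1,2,2,2,2,2,2,2,2,1,1,1,0,1,1,1,1,1,2,2,2,2,2,2,1,1,1,1,1]),
    (89, 44, [2,1,1,2,2,2,2,2,2,2,2,1,1,1,0,1,1,1,1,1,2,2,2,2,2,2,1,1,1,1,1,0,1,1,1,2,2,2,2,2,2,2,2,1,1,1,0,1,1,1,1,1,2,2,2,2,2,2,1,1,1,1,1]),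
    (96, 48, [2,1,1,2,2,2,2,1,1,1,1,2,2,2,2,2,2,2,2,1,1,1,1,2,2,2,2,1,1,1,1,1,1,1,1,2,2,2,2,1,1,1,1,2,2,2,2,2,2,2,2,1,1,1,1,2,2,2,2,1,1,1,1]),
    (97, 48, [3,1,1,2,2,2,2,1,1,1,1,2,2,2,2,2,2,2,2,1,1,1,1,2,2,2,2,1,1,1,1,1,1,1,1,2,2,2,2,1,1,1,1,2,2,2,2,2,2,2,2,1,1,1,1,2,2,2,2,1,1,1,1]),
    (100, 49, [1,0,2,2,2,2,2,2,2,2,2,0,2,1,2,1,2,2,2,2,1,2,1,2,1,2,1,1,2,2,2,0,2,0,1,2,2,2,2,2,2,2,2,1,2,1,1,2,2,2,1,2,1,2,1,2,1,2,1,2,2,2,1]),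
    (101, 50, [2,0,2,2,2,2,2,2,2,2,2,0,2,1,2,1,2,2,2,2,1,2,1,2,1,2,1,1,2,2,2,0,2,0,1,2,2,2,2,2,2,2,2,1,2,1,1,2,2,2,1,2,1,2,1,2,1,2,1,2,2,2,1]),
    (108, 54, [2,2,1,1,2,2,2,2,2,2,2,1,2,2,1,2,1,1,2,2,2,2,2,2,2,2,2,2,1,1,2,0,2,2,1,1,2,2,2,2,2,2,2,1,2,2,1,2,1,1,2,2,2,2,2,2,2,2,2,2,1,1,2]),
    (109, 54, [3,2,1,1,2,2,2,2,2,2,2,1,2,2,1,2,1,1,2,2,2,2,2,2,2,2,2,2,1,1,2,0,2,2,1,1,2,2,2,2,2,2,2,1,2,2,1,2,1,1,2,2,2,2,2,2,2,2,2,2,1,1,2])]"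

lemma lcd_multiplicities_valid:
  "list_all (\<lambda>(i, d, m). sum_list m = 51 + i \<and> 0 < d \<and> min_weight_ge m d \<and> gauss_norm_64 m)
     (zip [0..<63] (zip lcd_distances lcd_multiplicities))"
  by code_simp

lemma length_lcd_tables: "length lcd_distances = 63" "length lcd_multiplicities = 63"
  by code_simp+

lemma optimal_codes_valid:
  "list_all (\<lambda>(k, d, m). sum_list m = k \<and> 0 < d \<and> min_weight_ge m d) optimal_codes"
  by code_simp

lemma optimal_codes_parameters:
  "map (\<lambda>(k, d, m). (k, d)) optimal_codes =
    [(84, 41), (85, 42), (88, 44), (89, 44), (96, 48), (97, 48), (100, 49), (101, 50), (108, 54), (109, 54)]"
  by code_simp

section \<open>Existence and nonexistence in all lengths\<close>

lemma LCD_code_exists: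
  assumes i: "i < 63"
  obtains C where "linear_code (51 + i + 63 * q) 6 C" "LCD (51 + i + 63 * q) C"
    "lcd_distances ! i + 32 * q \<le> minimum_distance (51 + i + 63 * q) C"
proof -
  define d m where "d = lcd_distances ! i" and "m = lcd_multiplicities ! i"
  have "zip [0..<63] (zip lcd_distances lcd_multiplicities) ! i = (i, d, m)"
    using i by (simp add: length_lcd_tables d_def m_def)
  then have "(i, d, m) \<in> set (zip [0..<63] (zip lcd_distances lcd_multiplicities))"
    using i nth_mem[of i "zip [0..<63] (zip lcd_distances lcd_multiplicities)"]
    by (simp add: length_lcd_tables)
  then have valid: "sum_list m = 51 + i" "0 < d" "min_weight_ge m d" "gauss_norm_64 m"
    using lcd_multiplicities_valid unfolding list_all_iff by blast+
  show thesis
    using that[of "generated_code (columns q m)"] linear_code_columns[OF valid(3,2), of q]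
      LCD_columns[OF valid(3,2,4), of q] minimum_distance_columns[OF valid(3,2), of q]
    unfolding valid(1) d_def by blast
qed

lemma code_exists:
  assumes "(k, d) \<in> set (map (\<lambda>(k, d, m). (k, d)) optimal_codes)"
  obtains C where "linear_code (k + 63 * q) 6 C" "d + 32 * q \<le> minimum_distance (k + 63 * q) C"
proof -
  obtain m where "(k, d, m) \<in> set optimal_codes"
    using assms by auto
  then have valid: "sum_list m = k" "0 < d" "min_weight_ge m d"
    using optimal_codes_valid unfolding list_all_iff by blast+
  show thesis
    using that linear_code_columns[OF valid(3,2), of q] minimum_distance_columns[OF valid(3,2), of q]
    unfolding valid(1) by blast
qed

lemma d_l_less:
  assumes "linear_code (k + 63 * q) 6 C" "LCD (k + 63 * q) C"
    and short: "32 * k < 63 * b + 31 * (b mod 2) + 82"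
  shows "d_l (k + 63 * q) 6 < b + 32 * q"
proof (rule ccontr)
  assume long: "\<not> ?thesis"
  obtain C' where C': "linear_code (k + 63 * q) 6 C'" "LCD (k + 63 * q) C'"
    "minimum_distance (k + 63 * q) C' = d_l (k + 63 * q) 6"
    using d_l_attained[OF assms(1,2)] .
  have "b + 32 * q \<le> minimum_distance (k + 63 * q) C'"
    unfolding C'(3) using long by (rule leI)
  then have "63 * (b + 32 * q) + 31 * ((b + 32 * q) mod 2) + 82 \<le> 32 * (k + 63 * q)"
    by (rule LCD_length_ge[OF C'(1,2)])
  moreover have "(b + 32 * q) mod 2 = b mod 2"
    by presburger
  ultimately show False
    using short by simp
qed

lemma d_a_less:
  assumes "linear_code (k + 63 * q) 6 C"
    and short: "32 * k < 63 * b + 31 * (b mod 2)"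
  shows "d_a (k + 63 * q) 6 < b + 32 * q"
proof (rule ccontr)
  assume long: "\<not> ?thesis"
  obtain C' where C': "linear_code (k + 63 * q) 6 C'"
    "minimum_distance (k + 63 * q) C' = d_a (k + 63 * q) 6"
    using d_a_attained[OF assms(1)] .
  have "b + 32 * q \<le> minimum_distance (k + 63 * q) C'"
    unfolding C'(2) using long by (rule leI)
  then have "63 * (b + 32 * q) + 31 * ((b + 32 * q) mod 2) \<le> 32 * (k + 63 * q)"
    by (rule code_length_ge[OF C'(1)])
  moreover have "(b + 32 * q) mod 2 = b mod 2"
    by presburger
  ultimately show False
    using short by simp
qed

lemma d_a_less_of_2_mod_8:
  assumes "linear_code (k + 63 * q) 6 C" and short: "4 * k < 63 * m + 23"
  shows "d_a (k + 63 * q) 6 < 8 * m + 2 + 32 * q"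
proof (rule ccontr)
  assume long: "\<not> ?thesis"
  obtain C' where C': "linear_code (k + 63 * q) 6 C'"
    "minimum_distance (k + 63 * q) C' = d_a (k + 63 * q) 6"
    using d_a_attained[OF assms(1)] .
  have "8 * m + 2 + 32 * q \<le> minimum_distance (k + 63 * q) C'"
    unfolding C'(2) using long by (rule leI)
  then have "8 * (m + 4 * q) + 2 \<le> minimum_distance (k + 63 * q) C'"
    by (simp add: algebra_simps)
  then have "63 * (m + 4 * q) + 23 \<le> 4 * (k + 63 * q)"
    by (rule code_length_ge_of_2_mod_8[OF C'(1)])
  then show False
    using short by simp
qed

lemma d_l_le_d_a:
  assumes "linear_code n 6 C" "LCD n C"
  shows "d_l n 6 \<le> d_a n 6"
  using d_l_attained[OF assms] d_a_ge by (metis order_refl)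

lemma d_l_attains_table:
  assumes "i < 63"
  shows "lcd_distances ! i + 32 * q \<le> d_l (51 + i + 63 * q) 6"
    and "32 * (51 + i) < 63 * b + 31 * (b mod 2) + 82 \<Longrightarrow> d_l (51 + i + 63 * q) 6 < b + 32 * q"
    and "d_l (51 + i + 63 * q) 6 \<le> d_a (51 + i + 63 * q) 6"
proof -
  obtain C where C: "linear_code (51 + i + 63 * q) 6 C" "LCD (51 + i + 63 * q) C"
    "lcd_distances ! i + 32 * q \<le> minimum_distance (51 + i + 63 * q) C"
    using LCD_code_exists[OF assms] .
  show "lcd_distances ! i + 32 * q \<le> d_l (51 + i + 63 * q) 6"
    by (rule d_l_ge[OF C])
  show "d_l (51 + i + 63 * q) 6 < b + 32 * q" if "32 * (51 + i) < 63 * b + 31 * (b mod 2) + 82"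
    using d_l_less[OF C(1,2) that] .
  show "d_l (51 + i + 63 * q) 6 \<le> d_a (51 + i + 63 * q) 6"
    by (rule d_l_le_d_a[OF C(1,2)])
qed

text \<open>Position of the residue \<open>t\<close> in tables for the lengths 51 to 113: the
  representative is \<open>t\<close> itself from 51 on, and \<open>63 + t\<close> below, where 63 -
  51 = 12.\<close>

definition table_index :: "nat \<Rightarrow> nat" where
  "table_index t = (if t \<le> 50 then t + 12 else t - 51)"

text \<open>The inequality states that a distance one larger than the tabulated one violates the LCD
  length bound, so the table is optimal for these residues.\<close>

lemma lcd_distances_delta:
  "list_all (\<lambda>t. t \<in> {21, 22, 25, 26, 33, 34, 37, 38, 45, 46} \<or>
     int (lcd_distances ! table_index t) = delta t + (if t \<le> 50 then 32 else 0) \<and>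
     32 * (51 + int (table_index t)) < 63 * (1 + int (lcd_distances ! table_index t))
       + 31 * ((1 + int (lcd_distances ! table_index t)) mod 2) + 82) [0..<63]"
  by code_simp

lemma d_l_eq:
  assumes t: "t \<le> 62" "t \<notin> {21, 22, 25, 26, 33, 34, 37, 38, 45, 46}" and n: "63 * s + t \<ge> 51"
  shows "int (d_l (63 * s + t) 6) = 32 * int s + delta t"
proof -
  \<comment> \<open>For \<open>t \<le> 50\<close> the tabulated length \<open>63 + t\<close> already
    uses up one period of 63; \<open>n \<ge> 51\<close> forces \<open>s > 0\<close> there, so the
    subtraction does not truncate.\<close>
  define q where "q = (if t \<le> 50 then s - 1 else s)"
  let ?i = "table_index t" and ?b = "lcd_distances ! table_index t"
  have i: "?i < 63"
    using t(1) less_imp_diff_less[of t 63 51] by (simp add: table_index_def)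
  have "t \<in> set [0..<63]"
    using t(1) by simp
  then have table: "int ?b = delta t + (if t \<le> 50 then 32 else 0)"
    "32 * (51 + int ?i) < 63 * (1 + int ?b) + 31 * ((1 + int ?b) mod 2) + 82"
    using lcd_distances_delta t(2) unfolding list_all_iff by blast+
  have "int (32 * (51 + ?i)) < int (63 * Suc ?b + 31 * (Suc ?b mod 2) + 82)"
    using table(2) by (simp add: zmod_int)
  then have short: "32 * (51 + ?i) < 63 * Suc ?b + 31 * (Suc ?b mod 2) + 82"
    by (rule iffD1[OF of_nat_less_iff])
  have eq: "63 * s + t = 51 + ?i + 63 * q"
    using n t(1) by (cases s) (simp_all add: q_def table_index_def)
  have "d_l (63 * s + t) 6 = ?b + 32 * q"
    using d_l_attains_table(1)[OF i, of q] d_l_attains_table(2)[OF i short, of q] unfolding eq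
    by simp
  moreover have "32 * int q = 32 * int s - (if t \<le> 50 then 32 else 0)"
    using n by (cases s) (simp_all add: q_def)
  ultimately show ?thesis
    using table(1) by simp
qed

text \<open>\<open>a + 33\<close> is the first distance to be excluded, by averaging or, if it is 2
  modulo 8, by the residual bound.\<close>

lemma d_a_eq:
  assumes "(63 + t, 32 + a) \<in> set (map (\<lambda>(k, d, m). (k, d)) optimal_codes)"
    and "32 * (63 + t) < 63 * (a + 33) + 31 * ((a + 33) mod 2)
      \<or> (\<exists>m. a + 33 = 8 * m + 2 \<and> 4 * (63 + t) < 63 * m + 23)"
  shows "d_a (63 + t + 63 * q) 6 = 32 + a + 32 * q"
proof -
  obtain C where C: "linear_code (63 + t + 63 * q) 6 C"
    "32 + a + 32 * q \<le> minimum_distance (63 + t + 63 * q) C"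
    using code_exists[OF assms(1)] .
  have "d_a (63 + t + 63 * q) 6 < a + 33 + 32 * q"
    using assms(2) d_a_less[OF C(1)] d_a_less_of_2_mod_8[OF C(1)] by metis
  then show ?thesis
    using d_a_ge[OF C] by linarith
qed

theorem mainTheorem1:
  fixes s t n :: nat
  assumes t: "t \<le> 62"
    and n: "n = 63 * s + t"
    and n_ge: "n \<ge> 51"
  shows
    "(t \<notin> {21, 22, 25, 26, 33, 34, 37, 38, 45, 46} \<longrightarrow>
        int (d_l n 6) = 32 * int s + delta t) \<and>
     (t \<in> {21, 22, 26, 34, 37, 38, 46} \<longrightarrow>
        int (d_l n 6) \<in> {int (d_a n 6) - 1, int (d_a n 6)}) \<and>
     (t = 21 \<longrightarrow> d_a n 6 = 32 * s + 9) \<and>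
     (t = 22 \<longrightarrow> d_a n 6 = 32 * s + 10) \<and>
     (t = 26 \<longrightarrow> d_a n 6 = 32 * s + 12) \<and>
     (t = 34 \<longrightarrow> d_a n 6 = 32 * s + 16) \<and>
     (t = 37 \<longrightarrow> d_a n 6 = 32 * s + 17) \<and>
     (t = 38 \<longrightarrow> d_a n 6 = 32 * s + 18) \<and>
     (t = 46 \<longrightarrow> d_a n 6 = 32 * s + 22) \<and>
     (t \<in> {25, 33, 45} \<longrightarrow>
        int (d_l n 6) \<in> {int (d_a n 6) - 2, int (d_a n 6) - 1}) \<and>
     (t = 25 \<longrightarrow> d_a n 6 = 32 * s + 12) \<and>
     (t = 33 \<longrightarrow> d_a n 6 = 32 * s + 16) \<and>
     (t = 45 \<longrightarrow> d_a n 6 = 32 * s + 22)"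
proof -
  have part_b: "int (d_l n 6) \<in> {int (d_a n 6) - 1, int (d_a n 6)} \<and> d_a n 6 = 32 * s + a"
    if "(t, a) \<in> {(21, 9), (22, 10), (26, 12), (34, 16), (37, 17), (38, 18), (46, 22)}" for a
  proof -
    have "t \<le> 50"
      using that by auto
    then obtain q where s: "s = Suc q"
      using n n_ge by (cases s) auto
    have n': "n = 63 + t + 63 * q" "n = 51 + (t + 12) + 63 * q"
      by (simp_all add: n s)
    have "(63 + t, 32 + a) \<in> set (map (\<lambda>(k, d, m). (k, d)) optimal_codes)"
      unfolding optimal_codes_parameters using that by auto
    moreover have "32 * (63 + t) < 63 * (a + 33) + 31 * ((a + 33) mod 2)
      \<or> (\<exists>m. a + 33 = 8 * m + 2 \<and> 4 * (63 + t) < 63 * m + 23)"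
    proof (cases "t = 21 \<or> t = 37")
      case True
      \<comment> \<open>The distances to exclude are 42 = 8 * 5 + 2 and 50 = 8 * 6 + 2, which
        averaging permits at lengths 84 and 100.\<close>
      then have "a + 33 = 8 * (if t = 21 then 5 else 6) + 2 \<and> 4 * (63 + t) < 63 * (if t = 21 then 5 else 6) + 23"
        using that by auto
      then show ?thesis
        by blast
    next
      case False
      then show ?thesis
        using that by auto
    qed
    ultimately have "d_a n 6 = 32 + a + 32 * q"
      unfolding n'(1) by (rule d_a_eq)
    moreover have "d_l n 6 \<le> d_a n 6" "lcd_distances ! (t + 12) + 32 * q \<le> d_l n 6"
      unfolding n'(2) using \<open>t \<le> 50\<close> by (intro d_l_attains_table; simp)+
    \<comment> \<open>One below the optimum \<open>32 + a\<close>, which leaves the two stated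
      values.\<close>
    moreover have "lcd_distances ! (t + 12) = 31 + a"
      using that by (auto simp: lcd_distances_def)
    ultimately show ?thesis
      by (auto simp: s)
  qed
  have part_c: "int (d_l n 6) \<in> {int (d_a n 6) - 2, int (d_a n 6) - 1} \<and> d_a n 6 = 32 * s + a"
    if "(t, a) \<in> {(25, 12), (33, 16), (45, 22)}" for a
  proof -
    have "t \<le> 50"
      using that by auto
    then obtain q where s: "s = Suc q"
      using n n_ge by (cases s) auto
    have n': "n = 63 + t + 63 * q" "n = 51 + (t + 12) + 63 * q"
      by (simp_all add: n s)
    have "(63 + t, 32 + a) \<in> set (map (\<lambda>(k, d, m). (k, d)) optimal_codes)"
      unfolding optimal_codes_parameters using that by auto
    moreover have "32 * (63 + t) < 63 * (a + 33) + 31 * ((a + 33) mod 2)"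
      using that by auto
    ultimately have "d_a n 6 = 32 + a + 32 * q"
      unfolding n'(1) by (intro d_a_eq disjI1)
    \<comment> \<open>The LCD length bound excludes the optimum itself, and the tabulated code lies
      two below it.\<close>
    moreover have "d_l n 6 < 32 + a + 32 * q"
      unfolding n'(2) using \<open>t \<le> 50\<close> that by (intro d_l_attains_table) auto
    moreover have "lcd_distances ! (t + 12) + 32 * q \<le> d_l n 6"
      unfolding n'(2) using \<open>t \<le> 50\<close> by (intro d_l_attains_table) simp
    moreover have "lcd_distances ! (t + 12) = 30 + a"
      using that by (auto simp: lcd_distances_def)
    ultimately show ?thesis
      by (auto simp: s)
  qed
  have part_a: "int (d_l n 6) = 32 * int s + delta t"
    if "t \<notin> {21, 22, 25, 26, 33, 34, 37, 38, 45, 46}"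
    using d_l_eq[OF t that] n n_ge by simp
  show ?thesis
    using part_a part_b part_c by blast
qed

end
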